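(* Let $n\ge 1$ be an integer, and let $S^{2n+1}$ carry its standard contact structure and standard contact form $\alpha$, normalized so that the minimal period of a closed Reeb orbit is $1$. For every $\epsilon>0$ there exists a contact isotopy $\psi_t$, $t\in[0,1]$, of $S^{2n+1}$ (with $\psi_0=\mathrm{id}$) whose time-1 map $\psi_1$ has no translated points relative to $\alpha$, and which satisfies $$2\inf_{s\in\mathbb{R}}\mathrm{dist}_\alpha(\psi_1,R_s^\alpha)<1+\epsilon.$$
   Context: Standard contact form: on $\mathbb{R}^{2n+2}$ with coordinates $(p,q,x_1,y_1,\dots,x_n,y_n)$ let $\lambda=\frac12(p\,dq-q\,dp)+\frac12\sum_{i=1}^n(x_i\,dy_i-y_i\,dx_i)$. The sphere $S^{2n+1}$ is identified with $\{\pi|z|^2=1\}\subset\mathbb{R}^{2n+2}$, $\alpha$ is the restriction of $\lambda$ to it, and the contact structure is $\ker\alpha$. The Reeb flow $R_s^\alpha$ of $\alpha$ is 1-periodic. Contact isotopies: a contact isotopy is a smooth path $\psi_t$, $t\in[0,1]$, of contactomorphisms with $\psi_0=\mathrm{id}$. Translated points: given a contactomorphism $\psi$, let $\Sigma=\{x:(\psi^*\alpha)_x=\alpha_x\}$ be the set where the scaling factor is $1$. A translated point of $\psi$ relative to $\alpha$ is an $\alpha$-Reeb chord joining $\Sigma$ to $\psi(\Sigma)$, i.e. a segment of a Reeb flow line (length zero allowed) joining a point of $\Sigma$ to a point of $\psi(\Sigma)$. Shelukhin-Hofer distance: for contact isotopies $\psi_{0,t},\psi_{1,t}$, $t\in[0,1]$,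 of $Y=S^{2n+1}$, define $$\mathrm{dist}_\alpha(\psi_{0,t},\psi_{1,t})=\inf\int_0^1\max_{y\in Y}\left|\alpha_{\psi_{s,1}(y)}(\partial_s\psi_{s,1}(y))\right|ds,$$ where the infimum is over all smooth squares $\psi_{s,t}$, $(s,t)\in[0,1]^2$, of contactomorphisms which extend the given $\psi_{0,t},\psi_{1,t}$ (at $s=0$ and $s=1$) and satisfy $\psi_{s,0}=\mathrm{id}$ for all $s$. This is a pseudo-distance on the universal cover of the identity component of the contactomorphism group. In the claim, $\mathrm{dist}_\alpha(\psi_1,R_s^\alpha)$ denotes the distance between the isotopies $t\mapsto\psi_t$ and $t\mapsto R^\alpha_{ts}$, $t\in[0,1]$. *)

theory Defs
  imports "HOL-Analysis.Analysis"
begin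

subsection \<open>Smooth maps\<close>

(* Intended for open U only. *)
primrec Ck_on :: "nat \<Rightarrow> ('a::real_normed_vector \<Rightarrow> 'b::real_normed_vector) \<Rightarrow> 'a set \<Rightarrow> bool" where
  "Ck_on 0 f U \<longleftrightarrow> continuous_on U f"
| "Ck_on (Suc k) f U \<longleftrightarrow>
     (\<forall>x\<in>U. f differentiable (at x)) \<and>
     (\<forall>v. Ck_on k (\<lambda>x. frechet_derivative f (at x) v) U)"

(* On an arbitrary subset S, smoothness means having local C-infinity extensions. *)
definition smooth_map_on :: "'a::euclidean_space set \<Rightarrow> ('a \<Rightarrow> 'b::real_normed_vector) \<Rightarrow> bool" where
  "smooth_map_on S f \<longleftrightarrow>
     (\<forall>x\<in>S. \<exists>U F. open U \<and> x \<in> U \<and> (\<forall>k. Ck_on k F U) \<and> (\<forall>y\<in>S \<inter> U. F y = f y))"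

subsection \<open>The standard contact sphere\<close>

(* Points are (p + i q, (x_j + i y_j)_j); here n = CARD('n), so n \<ge> 1 holds automatically. *)
type_synonym 'n space = "complex \<times> (complex ^ 'n)"

definition liouville :: "'n::finite space \<Rightarrow> 'n space \<Rightarrow> real" where
  "liouville z v =
     (Re (fst z) * Im (fst v) - Im (fst z) * Re (fst v)) / 2 +
     (\<Sum>j\<in>UNIV. Re (snd z $ j) * Im (snd v $ j) - Im (snd z $ j) * Re (snd v $ j)) / 2"

definition csphere :: "'n::finite space set" where
  "csphere = {z. pi * (norm z)\<^sup>2 = 1}"

definition tangent :: "'n::finite space \<Rightarrow> 'n space set" where
  "tangent z = {v. z \<bullet> v = 0}"

(* The contact form is the restriction of liouville z to tangent z, for z in the sphere. *)
definition contact_plane :: "'n::finite space \<Rightarrow> 'n space set" where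
  "contact_plane z = {v \<in> tangent z. liouville z v = 0}"

(* A derivative within the sphere is determined only on vectors tangent to the sphere;
   sphere_deriv is applied to no others. *)
definition sphere_deriv ::
    "('n::finite space \<Rightarrow> 'n space) \<Rightarrow> 'n space \<Rightarrow> 'n space \<Rightarrow> 'n space" where
  "sphere_deriv \<psi> z = frechet_derivative \<psi> (at z within csphere)"

subsection \<open>The Reeb flow\<close>

(* The exterior derivative of a 1-form \<beta>, evaluated at z on constant vector fields u, v. *)
definition ext_deriv ::
    "('a::real_normed_vector \<Rightarrow> 'a \<Rightarrow> real) \<Rightarrow> 'a \<Rightarrow> 'a \<Rightarrow> 'a \<Rightarrow> real" where
  "ext_deriv \<beta> z u v =
     frechet_derivative (\<lambda>w. \<beta> w v) (at z) u - frechet_derivative (\<lambda>w. \<beta> w u) (at z) v"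

definition reeb_field :: "'n::finite space \<Rightarrow> 'n space" where
  "reeb_field z = (THE r. r \<in> tangent z \<and> liouville z r = 1 \<and>
     (\<forall>v\<in>tangent z. ext_deriv liouville z r v = 0))"

definition reeb_flow :: "real \<Rightarrow> 'n::finite space \<Rightarrow> 'n space" where
  "reeb_flow s z = (THE \<gamma>. \<gamma> 0 = z \<and>
     (\<forall>t. \<gamma> t \<in> csphere \<and> (\<gamma> has_vector_derivative reeb_field (\<gamma> t)) (at t))) s"

subsection \<open>Contactomorphisms and contact isotopies\<close>

(* Maps of the sphere are functions on the ambient space whose values off the sphere are ignored;
   similarly, only parameters in [0,1] matter for isotopies and squares. *)
definition contactomorphism :: "('n::finite space \<Rightarrow> 'n space) \<Rightarrow> bool" where
  "contactomorphism \<psi> \<longleftrightarrow>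
     bij_betw \<psi> csphere csphere \<and>
     smooth_map_on csphere \<psi> \<and>
     smooth_map_on csphere (the_inv_into csphere \<psi>) \<and>
     (\<forall>z\<in>csphere. sphere_deriv \<psi> z ` contact_plane z = contact_plane (\<psi> z))"

definition contact_isotopy :: "(real \<Rightarrow> 'n::finite space \<Rightarrow> 'n space) \<Rightarrow> bool" where
  "contact_isotopy \<psi> \<longleftrightarrow>
     smooth_map_on ({0..1} \<times> csphere) (\<lambda>(t, z). \<psi> t z) \<and>
     (\<forall>t\<in>{0..1}. contactomorphism (\<psi> t)) \<and>
     (\<forall>z\<in>csphere. \<psi> 0 z = z)"

subsection \<open>Translated points\<close>

definition unit_scaling_set :: "('n::finite space \<Rightarrow> 'n space) \<Rightarrow> 'n space set" where
  "unit_scaling_set \<psi> =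
     {z \<in> csphere. \<forall>v\<in>tangent z. liouville (\<psi> z) (sphere_deriv \<psi> z v) = liouville z v}"

(* The pair (z, s) encodes the chord t \<mapsto> reeb_flow t z, for t between 0 and s. *)
definition translated_points :: "('n::finite space \<Rightarrow> 'n space) \<Rightarrow> ('n space \<times> real) set" where
  "translated_points \<psi> =
     {(z, s). z \<in> unit_scaling_set \<psi> \<and> reeb_flow s z \<in> \<psi> ` unit_scaling_set \<psi>}"

subsection \<open>The Shelukhin-Hofer distance\<close>

definition isotopy_squares ::
    "(real \<Rightarrow> 'n::finite space \<Rightarrow> 'n space) \<Rightarrow> (real \<Rightarrow> 'n space \<Rightarrow> 'n space) \<Rightarrow>
     (real \<Rightarrow> real \<Rightarrow> 'n space \<Rightarrow> 'n space) set" where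
  "isotopy_squares \<psi>\<^sub>0 \<psi>\<^sub>1 = {\<Psi>.
     smooth_map_on ({0..1} \<times> {0..1} \<times> csphere) (\<lambda>(s, t, z). \<Psi> s t z) \<and>
     (\<forall>s\<in>{0..1}. \<forall>t\<in>{0..1}. contactomorphism (\<Psi> s t)) \<and>
     (\<forall>t\<in>{0..1}. \<forall>z\<in>csphere. \<Psi> 0 t z = \<psi>\<^sub>0 t z \<and> \<Psi> 1 t z = \<psi>\<^sub>1 t z) \<and>
     (\<forall>s\<in>{0..1}. \<forall>z\<in>csphere. \<Psi> s 0 z = z)}"

(* The supremum over the compact sphere is a maximum. *)
definition hofer_length :: "(real \<Rightarrow> 'n::finite space \<Rightarrow> 'n space) \<Rightarrow> ennreal" where
  "hofer_length \<phi> = (\<integral>\<^sup>+s\<in>{0..1}. (SUP z\<in>csphere.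
     ennreal \<bar>liouville (\<phi> s z) (vector_derivative (\<lambda>r. \<phi> r z) (at s within {0..1}))\<bar>) \<partial>lborel)"

definition hofer_dist ::
    "(real \<Rightarrow> 'n::finite space \<Rightarrow> 'n space) \<Rightarrow> (real \<Rightarrow> 'n space \<Rightarrow> 'n space) \<Rightarrow> ennreal" where
  "hofer_dist \<psi>\<^sub>0 \<psi>\<^sub>1 = (INF \<Psi>\<in>isotopy_squares \<psi>\<^sub>0 \<psi>\<^sub>1. hofer_length (\<lambda>s. \<Psi> s 1))"

end

theory Submission imports Defs begin

text \<open>
Write \<open>fst z = x + \<i> y\<close>, and let \<open>\<rho> = |z|\<^sup>2 - x\<^sup>2 - y\<^sup>2\<close>, the squared length of the remaining
coordinates. The isotopy is essentially the flow of the autonomous contact Hamiltonian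
\<open>H = - c tanh (y / d)\<close> with \<open>c\<close> slightly larger than 1/2 and \<open>d\<close> very small. Where \<open>y\<close> is much larger
than \<open>d\<close>, \<open>H\<close> is nearly constant and the flow is the Reeb flow run backwards at speed \<open>c\<close>; where \<open>y\<close> is
much smaller than \<open>- d\<close>, it is the Reeb flow run forwards at speed \<open>c\<close>. So both halves of the sphere
turn from the side \<open>x < 0\<close> to the side \<open>x > 0\<close>, over half a Reeb orbit in a time slightly less than 1,
and in the thin strip between them the flow pushes very strongly in the same direction. The energy is
only \<open>c\<close>, because \<open>|H| \<le> c\<close>.

The logarithm of the scaling factor changes along the flow at the rate \<open>dH (R)\<close>, where \<open>R\<close> is the Reeb
field, and \<open>log \<rho>\<close> changes at the same rate. So at a point with scaling factor 1 at time 1, \<open>\<rho>\<close> has the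
same value at the times 0 and 1 (\<open>unit_scaling_imp_rho_eq\<close>). This is impossible unless \<open>\<rho>\<close> is small: \<open>x\<close>
increases along the flow, which makes \<open>\<rho>\<close> first grow and then shrink, so \<open>\<rho>\<close> would be bounded below
during the whole unit of time; but then the point is turned or pushed further than there is room
(\<open>no_return\<close>). Hence the set of points with scaling factor 1 and its image under the time-1 map both
lie in a thin neighbourhood \<open>\<rho> < q\<close> of a single closed Reeb orbit. Since \<open>\<rho>\<close> is invariant under the
Reeb flow, composing the flow with a unitary rotation through a small angle, which is a strict
contactomorphism of small energy and moves this orbit off itself, destroys all translated points
(\<open>rho_rot_disjoint\<close>). Retracing the isotopy to the identity, which is the Reeb flow at time 0, gives a
path of length at most \<open>c\<close> plus the energy of the rotation, and twice this is less than \<open>1 + \<epsilon>\<close>.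

The analytic input is that the flow of a smooth vector field is smooth. Existence is Picard's theorem.
For smoothness in the initial value, a difference quotient of solutions solves a linear equation whose
coefficients depend continuously on the step size up to and including 0; this gives one derivative
(\<open>ode_parameter_derivative\<close>), which solves an equation of the same kind, so that induction gives all
of them (\<open>ode_solution_Ck\<close>). The vector field is extended to the ambient space so as to be tangent to
all spheres around the origin, which makes its flow complete.
\<close>

section \<open>Calculus of C-k maps\<close>

lemma Ck_on_SucI:
  assumes "\<And>x. (f has_derivative f' x) (at x)"
    and "\<And>v. Ck_on k (\<lambda>x. f' x v) UNIV"
  shows "Ck_on (Suc k) f UNIV"
proof -
  have "frechet_derivative f (at x) = f' x" for x
    using frechet_derivative_at[OF assms(1)] by simp
  then show ?thesis
    using assms by (auto simp: differentiable_def)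
qed

lemma Ck_on_Suc_has_derivative:
  assumes "Ck_on (Suc k) f UNIV"
  shows "(f has_derivative frechet_derivative f (at x)) (at x)"
  using assms by (auto simp: frechet_derivative_works[symmetric])

lemma Ck_on_Suc_derivative:
  assumes "Ck_on (Suc k) f UNIV" "\<And>x. (f has_derivative f' x) (at x)"
  shows "Ck_on k (\<lambda>x. f' x v) UNIV"
proof -
  have "frechet_derivative f (at x) = f' x" for x
    using frechet_derivative_at[OF assms(2)] by simp
  then show ?thesis using assms(1) by simp
qed

lemma Ck_on_continuous: "Ck_on k f UNIV \<Longrightarrow> continuous_on UNIV f"
proof (cases k)
  case (Suc j)
  moreover assume "Ck_on k f UNIV"
  ultimately show ?thesis
    by (metis Ck_on_Suc_has_derivative continuous_at_imp_continuous_on has_derivative_continuous)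
qed simp

lemma Ck_on_Suc_imp: "Ck_on (Suc k) f UNIV \<Longrightarrow> Ck_on k f UNIV"
proof (induction k arbitrary: f)
  case 0
  then show ?case using Ck_on_continuous by fastforce
next
  case (Suc k)
  from Suc.prems have "Ck_on (Suc k) (\<lambda>x. frechet_derivative f (at x) v) UNIV" for v by simp
  then have "Ck_on k (\<lambda>x. frechet_derivative f (at x) v) UNIV" for v by (rule Suc.IH)
  then show ?case using Ck_on_Suc_has_derivative[OF Suc.prems] by (intro Ck_on_SucI)
qed

lemma Ck_on_const: "Ck_on k (\<lambda>x. c) UNIV"
proof (induction k arbitrary: c)
  case (Suc k)
  show ?case by (rule Ck_on_SucI[where f'="\<lambda>_ _. 0"]) (auto intro: Suc)
qed simp

lemma Ck_on_bounded_linear: "bounded_linear f \<Longrightarrow> Ck_on k f UNIV"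
proof (cases k)
  case 0
  assume "bounded_linear f"
  then show ?thesis using 0 by (simp add: linear_continuous_on)
next
  case (Suc j)
  assume "bounded_linear f"
  then have "Ck_on (Suc j) f UNIV"
    by (intro Ck_on_SucI[where f'="\<lambda>_. f"] bounded_linear_imp_has_derivative Ck_on_const)
  then show ?thesis using Suc by simp
qed

lemma Ck_on_add:
  "Ck_on k f UNIV \<Longrightarrow> Ck_on k g UNIV \<Longrightarrow> Ck_on k (\<lambda>x. f x + g x) UNIV"
proof (induction k arbitrary: f g)
  case 0
  then show ?case by (auto intro: continuous_on_add)
next
  case (Suc k)
  note f = Ck_on_Suc_has_derivative[OF Suc.prems(1)] and g = Ck_on_Suc_has_derivative[OF Suc.prems(2)]
  show ?case
    by (rule Ck_on_SucI[OF has_derivative_add[OF f g]]) (use Suc in auto)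
qed

lemma Ck_on_sum:
  "(\<And>i. i \<in> I \<Longrightarrow> Ck_on k (f i) UNIV) \<Longrightarrow> Ck_on k (\<lambda>x. \<Sum>i\<in>I. f i x) UNIV"
  by (induction I rule: infinite_finite_induct) (auto intro: Ck_on_const Ck_on_add)

lemma (in bounded_bilinear) Ck_on_prod:
  "Ck_on k f UNIV \<Longrightarrow> Ck_on k g UNIV \<Longrightarrow> Ck_on k (\<lambda>x. prod (f x) (g x)) UNIV"
proof (induction k arbitrary: f g)
  case 0
  then show ?case by (auto intro: continuous_on)
next
  case (Suc k)
  note f = Ck_on_Suc_has_derivative[OF Suc.prems(1)] and g = Ck_on_Suc_has_derivative[OF Suc.prems(2)]
  show ?case
    by (rule Ck_on_SucI[OF FDERIV[OF f g]])
       (use Suc in \<open>auto intro!: Ck_on_add Suc.IH intro: Ck_on_Suc_imp\<close>)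
qed

lemmas Ck_on_mult = bounded_bilinear.Ck_on_prod[OF bounded_bilinear_mult]
lemmas Ck_on_scaleR = bounded_bilinear.Ck_on_prod[OF bounded_bilinear_scaleR]
lemmas Ck_on_inner = bounded_bilinear.Ck_on_prod[OF bounded_bilinear_inner]

lemma Ck_on_minus: "Ck_on k f UNIV \<Longrightarrow> Ck_on k (\<lambda>x. - f x) UNIV"
  using Ck_on_scaleR[OF Ck_on_const[of k "-1"]] by fastforce

lemma Ck_on_diff:
  "Ck_on k f UNIV \<Longrightarrow> Ck_on k g UNIV \<Longrightarrow> Ck_on k (\<lambda>x. f x - g x) UNIV"
  using Ck_on_add[OF _ Ck_on_minus] by fastforce

lemma linear_eq_sum_Basis:
  fixes f :: "'a::euclidean_space \<Rightarrow> 'b::real_vector"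
  assumes "linear f"
  shows "f v = (\<Sum>b\<in>Basis. (v \<bullet> b) *\<^sub>R f b)"
proof -
  have "f v = f (\<Sum>b\<in>Basis. (v \<bullet> b) *\<^sub>R b)" by (simp add: euclidean_representation)
  then show ?thesis by (simp add: linear_sum[OF assms] linear_scale[OF assms])
qed

lemma Ck_on_linear_apply:
  fixes A :: "'a::euclidean_space \<Rightarrow> 'b::euclidean_space \<Rightarrow> 'c::real_normed_vector"
  assumes "\<And>x. linear (A x)" "\<And>v. Ck_on k (\<lambda>x. A x v) UNIV" "Ck_on k g UNIV"
  shows "Ck_on k (\<lambda>x. A x (g x)) UNIV"
proof -
  have "(\<lambda>x. A x (g x)) = (\<lambda>x. \<Sum>b\<in>Basis. (g x \<bullet> b) *\<^sub>R A x b)"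
    by (intro ext linear_eq_sum_Basis assms(1))
  then show ?thesis
    using assms by (auto intro!: Ck_on_sum Ck_on_scaleR Ck_on_inner Ck_on_const)
qed

lemma Ck_on_compose:
  fixes g :: "'a::euclidean_space \<Rightarrow> 'b::euclidean_space"
  shows "Ck_on k f UNIV \<Longrightarrow> Ck_on k g UNIV \<Longrightarrow> Ck_on k (\<lambda>x. f (g x)) UNIV"
proof (induction k arbitrary: f g)
  case 0
  then show ?case by (auto intro: continuous_on_compose2)
next
  case (Suc k)
  note f = Ck_on_Suc_has_derivative[OF Suc.prems(1)] and g = Ck_on_Suc_has_derivative[OF Suc.prems(2)]
  have "Ck_on k (\<lambda>x. frechet_derivative f (at (g x)) (frechet_derivative g (at x) v)) UNIV" for v
  proof (rule Ck_on_linear_apply)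
    show "linear (frechet_derivative f (at (g x)))" for x
      by (rule has_derivative_linear[OF f])
    show "Ck_on k (\<lambda>x. frechet_derivative f (at (g x)) w) UNIV" for w
      by (rule Suc.IH) (use Suc.prems Ck_on_Suc_imp in auto)
    show "Ck_on k (\<lambda>x. frechet_derivative g (at x) v) UNIV"
      using Suc.prems(2) by simp
  qed
  then show ?case
    by (intro Ck_on_SucI[OF has_derivative_compose[OF g f]])
qed

lemma Ck_on_Pair:
  assumes "Ck_on k f UNIV" "Ck_on k g UNIV"
  shows "Ck_on k (\<lambda>x. (f x, g x)) UNIV"
  using assms
proof (induction k arbitrary: f g)
  case 0
  then show ?case by (auto intro: continuous_on_Pair)
next
  case (Suc k)
  note f = Ck_on_Suc_has_derivative[OF Suc.prems(1)] and g = Ck_on_Suc_has_derivative[OF Suc.prems(2)]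
  show ?case
    by (rule Ck_on_SucI[OF has_derivative_Pair[OF f g]]) (use Suc in auto)
qed

text \<open>Solutions of autonomous differential equations are smooth because their derivative is a
  smooth expression in the function itself; for tanh the equation is \<open>y' = 1 - y\<^sup>2\<close>.\<close>

lemma Ck_on_tanh: "Ck_on k (tanh :: real \<Rightarrow> real) UNIV"
proof (induction k)
  case 0
  show ?case by (auto intro!: continuous_intros)
next
  case (Suc k)
  have "((tanh :: real \<Rightarrow> real) has_derivative (\<lambda>v. (1 - tanh x * tanh x) * v)) (at x)" for x
    using has_field_derivative_tanh[OF _ DERIV_ident, of x UNIV]
    by (simp add: has_field_derivative_def power2_eq_square)
  then show ?case
    by (rule Ck_on_SucI) (intro Ck_on_mult Ck_on_diff Ck_on_const Suc)
qed

lemma Ck_on_sin_cos: "Ck_on k (sin :: real \<Rightarrow> real) UNIV \<and> Ck_on k (cos :: real \<Rightarrow> real) UNIV"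
proof (induction k)
  case 0
  show ?case by (auto intro!: continuous_intros)
next
  case (Suc k)
  have "((sin :: real \<Rightarrow> real) has_derivative (\<lambda>v. cos x * v)) (at x)"
    "((cos :: real \<Rightarrow> real) has_derivative (\<lambda>v. (- sin x) * v)) (at x)" for x
    by (auto intro!: derivative_eq_intros)
  then show ?case
    using Suc by (auto simp del: Ck_on.simps intro!: Ck_on_SucI Ck_on_mult Ck_on_minus Ck_on_const)
qed

text \<open>A map that is differentiable in each of two variables is jointly differentiable as soon as one of
  the two partial derivatives is continuous; here this is the derivative in the time variable.\<close>

lemma Ck_on_Suc_partials:
  fixes g :: "real \<times> 'p::real_normed_vector \<Rightarrow> 'b::real_normed_vector"
  assumes t: "\<And>t p. ((\<lambda>s. g (s, p)) has_vector_derivative gt (t, p)) (at t)"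
    and p: "\<And>t p. ((\<lambda>q. g (t, q)) has_derivative gp (t, p)) (at p)"
    and Ct: "Ck_on k gt UNIV" and Cp: "\<And>w. Ck_on k (\<lambda>tp. gp tp w) UNIV"
  shows "Ck_on (Suc k) g UNIV"
proof (rule Ck_on_SucI)
  have cont: "continuous_on UNIV gt" by (rule Ck_on_continuous[OF Ct])
  have swapped: "((\<lambda>(q, s). g (s, q)) has_derivative (\<lambda>(w, s). gp (t, p) w + s *\<^sub>R gt (t, p)))
      (at (p, t))" for t p
  proof -
    have blf: "((\<lambda>s. g (s, q)) has_derivative blinfun_apply (blinfun_scaleR_left (gt (s, q)))) (at s)"
      for s q
      using t[where t=s and p=q] by (simp add: has_vector_derivative_def)
    have "continuous_on UNIV (\<lambda>z. blinfun_scaleR_left (gt (snd z, fst z)))"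
      by (intro bounded_linear.continuous_on[OF bounded_linear_blinfun_scaleR_left]
          continuous_on_compose2[OF cont] continuous_intros) auto
    then have cb: "continuous (at (p, t) within UNIV \<times> UNIV)
        (\<lambda>(q, s). blinfun_scaleR_left (gt (s, q)))"
      by (simp add: case_prod_unfold continuous_on_eq_continuous_at)
    have "((\<lambda>(q, s). g (s, q)) has_derivative
        (\<lambda>(w, s). gp (t, p) w + blinfun_apply (blinfun_scaleR_left (gt (t, p))) s))
      (at (p, t) within UNIV \<times> UNIV)"
      by (rule has_derivative_partialsI[where Y=UNIV and X=UNIV]) (use p blf cb in auto)
    then show ?thesis by simp
  qed
  fix z :: "real \<times> 'p"
  obtain t p where z: "z = (t, p)" by (cases z)
  have "((\<lambda>y. (snd y, fst y)) has_derivative (\<lambda>y. (snd y, fst y))) (at (t, p))"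
    for t and p :: 'p
    by (auto intro!: derivative_eq_intros)
  from has_derivative_compose[OF this, of "\<lambda>(q, s). g (s, q)" "\<lambda>(w, s). gp (t, p) w + s *\<^sub>R gt (t, p)" t p]
  show "(g has_derivative (\<lambda>(s, w). gp z w + s *\<^sub>R gt z)) (at z)"
    using swapped by (simp add: z case_prod_unfold)
next
  fix v :: "real \<times> 'p"
  show "Ck_on k (\<lambda>z. (case v of (s, w) \<Rightarrow> gp z w + s *\<^sub>R gt z)) UNIV"
    by (cases v) (use Ct Cp in \<open>auto intro!: Ck_on_add Ck_on_scaleR Ck_on_const\<close>)
qed

section \<open>Existence, uniqueness and smooth dependence for ordinary differential equations\<close>

lemma gronwall_forward:
  fixes u :: "real \<Rightarrow> 'a::real_inner"
  assumes der: "\<And>s. 0 \<le> s \<Longrightarrow> s \<le> t \<Longrightarrow> (u has_vector_derivative u' s) (at s)"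
    and bd: "\<And>s. 0 \<le> s \<Longrightarrow> s \<le> t \<Longrightarrow> norm (u' s) \<le> L * norm (u s) + e"
    and "0 \<le> L" "0 \<le> e" "0 \<le> t"
  shows "(norm (u t))\<^sup>2 \<le> ((norm (u 0))\<^sup>2 + e\<^sup>2) * exp ((2 * L + 1) * t)"
proof -
  let ?K = "2 * L + 1"
  let ?h = "\<lambda>s. (u s \<bullet> u s + e\<^sup>2) * exp (- (?K * s))"
  have "?h t \<le> ?h 0"
  proof (rule DERIV_nonpos_imp_nonincreasing[OF \<open>0 \<le> t\<close>])
    fix s assume s: "0 \<le> s" "s \<le> t"
    let ?d = "(2 * (u s \<bullet> u' s) - ?K * (u s \<bullet> u s + e\<^sup>2)) * exp (- (?K * s))"
    have "(?h has_real_derivative ?d) (at s)"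
      using der[OF s] unfolding has_vector_derivative_def has_field_derivative_def
      by (auto intro!: derivative_eq_intros simp: fun_eq_iff inner_commute algebra_simps)
    moreover have "?d \<le> 0"
    proof (rule mult_nonpos_nonneg)
      have "u s \<bullet> u' s \<le> norm (u s) * norm (u' s)" by (rule norm_cauchy_schwarz)
      also have "\<dots> \<le> norm (u s) * (L * norm (u s) + e)"
        by (intro mult_left_mono bd s) auto
      finally have "2 * (u s \<bullet> u' s) \<le> 2 * L * (norm (u s))\<^sup>2 + 2 * (norm (u s) * e)"
        by (simp add: power2_eq_square algebra_simps)
      also have "\<dots> \<le> 2 * L * (norm (u s))\<^sup>2 + ((norm (u s))\<^sup>2 + e\<^sup>2)"
        using sum_squares_bound[of "norm (u s)" e] by simp
      also have "\<dots> \<le> ?K * ((norm (u s))\<^sup>2 + e\<^sup>2)"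
        using \<open>0 \<le> L\<close> by (simp add: algebra_simps)
      finally show "2 * (u s \<bullet> u' s) - ?K * (u s \<bullet> u s + e\<^sup>2) \<le> 0"
        by (simp add: power2_norm_eq_inner)
    qed simp
    ultimately show "\<exists>y. (?h has_real_derivative y) (at s) \<and> y \<le> 0" by blast
  qed
  then have "?h t * exp (?K * t) \<le> ?h 0 * exp (?K * t)" by (rule mult_right_mono) simp
  then have "(u t \<bullet> u t + e\<^sup>2) \<le> (u 0 \<bullet> u 0 + e\<^sup>2) * exp (?K * t)"
    by (simp add: mult.assoc flip: exp_add)
  then show ?thesis
    by (simp add: power2_norm_eq_inner) (smt (verit) zero_le_power2)
qed

text \<open>Gronwall's inequality for the squared norm: squaring avoids the points where the norm is
  not differentiable, and keeps the bound small when \<open>u 0\<close> and \<open>e\<close> are.\<close>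

lemma gronwall:
  fixes u :: "real \<Rightarrow> 'a::real_inner"
  assumes der: "\<And>s. \<bar>s\<bar> \<le> \<bar>t\<bar> \<Longrightarrow> (u has_vector_derivative u' s) (at s)"
    and bd: "\<And>s. \<bar>s\<bar> \<le> \<bar>t\<bar> \<Longrightarrow> norm (u' s) \<le> L * norm (u s) + e"
    and "0 \<le> L" "0 \<le> e"
  shows "(norm (u t))\<^sup>2 \<le> ((norm (u 0))\<^sup>2 + e\<^sup>2) * exp ((2 * L + 1) * \<bar>t\<bar>)"
proof (cases "0 \<le> t")
  case True
  then show ?thesis using gronwall_forward[of t u u' L e] assms by auto
next
  case False
  have "((\<lambda>s. u (- s)) has_vector_derivative - u' (- s)) (at s)" if "0 \<le> s" "s \<le> - t" for s
  proof -
    have "(u has_vector_derivative u' (- s)) (at (- s))" using that False by (intro der) auto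
    moreover have "(uminus has_real_derivative - 1) (at s)" by (auto intro!: derivative_eq_intros)
    ultimately have "((u \<circ> uminus) has_vector_derivative (- 1) *\<^sub>R u' (- s)) (at s)"
      by (intro vector_diff_chain_at) (auto simp: has_real_derivative_iff_has_vector_derivative)
    then show ?thesis by (simp add: o_def)
  qed
  from gronwall_forward[of "- t" "\<lambda>s. u (- s)" "\<lambda>s. - u' (- s)" L e, OF this]
  show ?thesis using False assms by auto
qed

lemma ode_zero:
  fixes u :: "real \<Rightarrow> 'a::real_inner"
  assumes "\<And>s. \<bar>s\<bar> \<le> \<bar>t\<bar> \<Longrightarrow> (u has_vector_derivative u' s) (at s)"
    and "\<And>s. \<bar>s\<bar> \<le> \<bar>t\<bar> \<Longrightarrow> norm (u' s) \<le> L * norm (u s)" and "0 \<le> L" and "u 0 = 0"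
  shows "u t = 0"
  using gronwall[of t u u' L 0] assms by (auto simp: zero_le_power2)

lemma antiderivative_on_reals:
  fixes g :: "real \<Rightarrow> 'a::euclidean_space"
  assumes "continuous_on UNIV g"
  shows "\<exists>G. G 0 = 0 \<and> (\<forall>t. (G has_vector_derivative g t) (at t))"
proof (intro exI conjI allI)
  fix t :: real
  let ?b = "\<bar>t\<bar> + 1"
  have "((\<lambda>u. LBINT y=ereal 0..ereal u. g y) has_vector_derivative g t) (at t within {-?b..?b})"
    by (rule interval_integral_FTC2) (auto intro: continuous_on_subset[OF assms])
  moreover have "- ?b < t" "t < ?b" by linarith+
  then have "t \<in> interior {-?b..?b}" by (simp add: interior_atLeastAtMost_real del: minus_add_distrib)
  ultimately show "((\<lambda>u. LBINT y=ereal 0..ereal u. g y) has_vector_derivative g t) (at t)"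
    by (metis at_within_interior)
qed simp

lemma norm_antiderivative_le_exp:
  fixes H :: "real \<Rightarrow> 'a::real_normed_vector"
  assumes der: "\<And>t. (H has_vector_derivative h t) (at t)" and "H 0 = 0"
    and bd: "\<And>t. norm (h t) \<le> C * exp (K * \<bar>t\<bar>)" and "0 < K" "0 \<le> C"
  shows "norm (H t) \<le> C / K * exp (K * \<bar>t\<bar>)"
proof -
  have *: "norm (F s) \<le> C / K * exp (K * s)"
    if F: "\<And>t. (F has_vector_derivative f t) (at t)" "F 0 = 0"
      and f: "\<And>t. norm (f t) \<le> C * exp (K * \<bar>t\<bar>)" and s: "0 < s"
    for F :: "real \<Rightarrow> 'a" and f s
  proof -
    have "norm (F s - F 0) \<le> C / K * exp (K * s) - C / K * exp (K * 0)"
    proof (rule differentiable_bound_general[OF s])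
      show "continuous_on {0..s} F"
        using F(1) by (meson continuous_at_imp_continuous_on has_vector_derivative_continuous)
      show "continuous_on {0..s} (\<lambda>s. C / K * exp (K * s))" by (intro continuous_intros)
      show "((\<lambda>s. C / K * exp (K * s)) has_vector_derivative C * exp (K * x)) (at x)" for x
        using \<open>0 < K\<close> unfolding has_real_derivative_iff_has_vector_derivative[symmetric]
        by (auto intro!: derivative_eq_intros)
      show "norm (f x) \<le> C * exp (K * x)" if "0 < x" for x using f[of x] that by simp
    qed (use F in auto)
    moreover have "0 \<le> C / K" using assms by simp
    ultimately show ?thesis using F(2) by simp
  qed
  consider "0 < t" | "t = 0" | "t < 0" by linarith
  then show ?thesis
  proof cases
    case 1
    then show ?thesis using *[OF der \<open>H 0 = 0\<close> bd] by simp
  next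
    case 2
    then show ?thesis using assms by simp
  next
    case 3
    have "((\<lambda>s. H (- s)) has_vector_derivative - h (- s)) (at s)" for s
    proof -
      have "(uminus has_real_derivative - 1) (at s)" by (auto intro!: derivative_eq_intros)
      then have "((H \<circ> uminus) has_vector_derivative (- 1) *\<^sub>R h (- s)) (at s)"
        using der[of "- s"]
        by (intro vector_diff_chain_at) (auto simp: has_real_derivative_iff_has_vector_derivative)
      then show ?thesis by (simp add: o_def)
    qed
    from *[of "\<lambda>s. H (- s)" "\<lambda>s. - h (- s)" "- t", OF this] bd[of "- _"] \<open>H 0 = 0\<close> 3
    show ?thesis by simp
  qed
qed

text \<open>The Picard iteration contracts the sup norm weighted by \<open>exp (- K \<bar>t\<bar>)\<close> once \<open>K\<close> exceeds twice
  the Lipschitz constant; the weight gives a solution on the whole line in one step. Bounded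
  continuous functions \<open>u\<close> stand for the curves \<open>exp (K \<bar>t\<bar>) u(t)\<close>.\<close>

lemma global_solution_lipschitz:
  fixes f :: "real \<Rightarrow> 'a::euclidean_space \<Rightarrow> 'a"
  assumes cont: "continuous_on UNIV (\<lambda>(t, y). f t y)"
    and lip: "\<And>t u v. norm (f t u - f t v) \<le> L * norm (u - v)"
    and bd: "\<And>t. norm (f t 0) \<le> B"
  shows "\<exists>\<gamma>. \<gamma> 0 = z \<and> (\<forall>t. (\<gamma> has_vector_derivative f t (\<gamma> t)) (at t))"
proof -
  define K where "K = 2 * \<bar>L\<bar> + 1"
  have K: "0 < K" "\<bar>L\<bar> / K \<le> 1 / 2" by (auto simp: K_def field_simps)
  have lip': "norm (f t u - f t v) \<le> \<bar>L\<bar> * norm (u - v)" for t u v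
    using lip[of t u v] mult_right_mono[of L "\<bar>L\<bar>" "norm (u - v)"] by fastforce
  have B: "0 \<le> B" using bd[of 0] norm_ge_zero order_trans by blast
  define g where "g = (\<lambda>(u :: real \<Rightarrow>\<^sub>C 'a) s. f s (exp (K * \<bar>s\<bar>) *\<^sub>R apply_bcontfun u s))"
  have contg: "continuous_on UNIV (g u)" for u
    unfolding g_def by (rule continuous_on_compose2[OF cont, of _ "\<lambda>s. (s, exp (K * \<bar>s\<bar>) *\<^sub>R apply_bcontfun u s)", simplified])
      (intro continuous_intros continuous_on_apply_bcontfun)
  have "\<forall>u. \<exists>G. G 0 = 0 \<and> (\<forall>t. (G has_vector_derivative g u t) (at t))"
    by (intro allI antiderivative_on_reals contg)
  then obtain G where G0: "\<And>u. G u 0 = 0" and G: "\<And>u t. (G u has_vector_derivative g u t) (at t)"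
    by metis
  have contG: "continuous_on UNIV (G u)" for u
    using G by (meson continuous_at_imp_continuous_on has_vector_derivative_continuous)
  define S where "S = (\<lambda>u t. exp (- (K * \<bar>t\<bar>)) *\<^sub>R (z + G u t))"
  have S: "S u \<in> bcontfun" for u
  proof (rule bcontfun_normI)
    show "continuous_on UNIV (S u)" unfolding S_def by (intro continuous_intros contG)
    fix t
    have gb: "norm (g u s) \<le> (B + \<bar>L\<bar> * norm u) * exp (K * \<bar>s\<bar>)" for s
    proof -
      have "norm (g u s) \<le> norm (f s 0) + norm (g u s - f s 0)" by norm
      also have "\<dots> \<le> B + \<bar>L\<bar> * norm (exp (K * \<bar>s\<bar>) *\<^sub>R apply_bcontfun u s - 0)"
        unfolding g_def by (intro add_mono bd lip')
      also have "\<dots> \<le> B * exp (K * \<bar>s\<bar>) + \<bar>L\<bar> * norm u * exp (K * \<bar>s\<bar>)"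
      proof (rule add_mono)
        show "B \<le> B * exp (K * \<bar>s\<bar>)" using B K by (simp add: mult_le_cancel_left1)
        show "\<bar>L\<bar> * norm (exp (K * \<bar>s\<bar>) *\<^sub>R apply_bcontfun u s - 0) \<le> \<bar>L\<bar> * norm u * exp (K * \<bar>s\<bar>)"
          using norm_bounded[of u s] by (simp add: mult_left_mono mult.assoc mult.commute)
      qed
      finally show ?thesis by (simp add: algebra_simps)
    qed
    have "norm (G u t) \<le> (B + \<bar>L\<bar> * norm u) / K * exp (K * \<bar>t\<bar>)"
      by (rule norm_antiderivative_le_exp[OF G G0 gb]) (use K B in auto)
    then have "norm (z + G u t) \<le> (norm z + (B + \<bar>L\<bar> * norm u) / K) * exp (K * \<bar>t\<bar>)"
      using K mult_left_mono[of 1 "exp (K * \<bar>t\<bar>)" "norm z"]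
      by (intro order_trans[OF norm_triangle_ineq]) (simp add: distrib_right)
    then have "exp (- (K * \<bar>t\<bar>)) * norm (z + G u t)
        \<le> exp (- (K * \<bar>t\<bar>)) * ((norm z + (B + \<bar>L\<bar> * norm u) / K) * exp (K * \<bar>t\<bar>))"
      by (rule mult_left_mono) simp
    also have "\<dots> = norm z + (B + \<bar>L\<bar> * norm u) / K"
      by (simp add: exp_minus)
    finally show "norm (S u t) \<le> norm z + (B + \<bar>L\<bar> * norm u) / K"
      by (simp add: S_def)
  qed
  have "dist (Bcontfun (S u)) (Bcontfun (S v)) \<le> 1 / 2 * dist u v" for u v
  proof (rule dist_bound)
    fix t
    have gb: "norm (g u s - g v s) \<le> \<bar>L\<bar> * dist u v * exp (K * \<bar>s\<bar>)" for s
    proof -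
      have "norm (g u s - g v s) \<le> \<bar>L\<bar> * norm (exp (K * \<bar>s\<bar>) *\<^sub>R (apply_bcontfun u s - apply_bcontfun v s))"
        unfolding g_def by (rule order_trans[OF lip']) (simp add: scaleR_diff_right)
      also have "\<dots> \<le> \<bar>L\<bar> * (exp (K * \<bar>s\<bar>) * dist u v)"
        using dist_bounded[of u s v] by (simp add: dist_norm mult_left_mono)
      finally show ?thesis by (simp add: algebra_simps)
    qed
    have "norm (G u t - G v t) \<le> (\<bar>L\<bar> * dist u v) / K * exp (K * \<bar>t\<bar>)"
      by (rule norm_antiderivative_le_exp[OF has_vector_derivative_diff[OF G G] _ gb])
        (use K G0 in auto)
    also have "\<dots> \<le> 1 / 2 * dist u v * exp (K * \<bar>t\<bar>)"
      using mult_right_mono[OF K(2), of "dist u v"] by (intro mult_right_mono) auto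
    finally have "exp (- (K * \<bar>t\<bar>)) * norm (G u t - G v t) \<le> 1 / 2 * dist u v"
      by (simp add: exp_minus field_simps)
    moreover have "S u t - S v t = exp (- (K * \<bar>t\<bar>)) *\<^sub>R (G u t - G v t)"
      by (simp add: S_def algebra_simps)
    ultimately show "dist (apply_bcontfun (Bcontfun (S u)) t) (apply_bcontfun (Bcontfun (S v)) t) \<le> 1 / 2 * dist u v"
      by (simp add: Bcontfun_inverse S dist_norm)
  qed
  then obtain u where "Bcontfun (S u) = u"
    using banach_fix_type[of "1/2" "\<lambda>u. Bcontfun (S u)"] by auto
  then have u: "apply_bcontfun u t = S u t" for t by (metis Bcontfun_inverse S)
  define \<gamma> where "\<gamma> = (\<lambda>t. z + G u t)"
  have "exp (K * \<bar>t\<bar>) *\<^sub>R apply_bcontfun u t = \<gamma> t" for t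
    by (simp add: u S_def \<gamma>_def exp_minus)
  then have "g u t = f t (\<gamma> t)" for t by (simp add: g_def)
  then have "(\<gamma> has_vector_derivative f t (\<gamma> t)) (at t)" for t
    using has_vector_derivative_add[OF has_vector_derivative_const G, of z u t]
    by (simp add: \<gamma>_def)
  moreover have "\<gamma> 0 = z" by (simp add: \<gamma>_def G0)
  ultimately show ?thesis by blast
qed

subsection \<open>Linear equations\<close>

text \<open>A family of linear maps that is continuous on each fixed vector is automatically locally bounded
  and jointly continuous, by expansion in a basis.\<close>

lemma linear_family_bounded:
  fixes A :: "'p::topological_space \<Rightarrow> 'a::euclidean_space \<Rightarrow> 'b::real_normed_vector"
  assumes lin: "\<And>p. linear (A p)" and cont: "\<And>v. continuous_on S (\<lambda>p. A p v)" and "compact S"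
  obtains L where "0 \<le> L" "\<And>p v. p \<in> S \<Longrightarrow> norm (A p v) \<le> L * norm v"
proof -
  have "\<exists>M. \<forall>p\<in>S. norm (A p b) \<le> M" for b
    using compact_imp_bounded[OF compact_continuous_image[OF cont \<open>compact S\<close>]]
    by (auto simp: bounded_iff)
  then obtain M where M: "\<And>b p. p \<in> S \<Longrightarrow> norm (A p b) \<le> M b" by metis
  have "norm (A p v) \<le> (\<Sum>b\<in>Basis. \<bar>M b\<bar>) * norm v" if "p \<in> S" for p v
  proof -
    have "norm (A p v) = norm (\<Sum>b\<in>Basis. (v \<bullet> b) *\<^sub>R A p b)"
      using linear_eq_sum_Basis[OF lin] by metis
    also have "\<dots> \<le> (\<Sum>b\<in>Basis. norm v * \<bar>M b\<bar>)"
    proof (rule sum_norm_le)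
      fix b :: 'a assume "b \<in> Basis"
      then show "norm ((v \<bullet> b) *\<^sub>R A p b) \<le> norm v * \<bar>M b\<bar>"
        using M[OF that, of b] Basis_le_norm[of b v] by (auto intro!: mult_mono)
    qed
    finally show ?thesis by (simp add: sum_distrib_left mult.commute)
  qed
  then show ?thesis by (intro that[of "\<Sum>b\<in>Basis. \<bar>M b\<bar>"]) (auto intro: sum_nonneg)
qed

lemma linear_family_continuous:
  fixes A :: "'p::topological_space \<Rightarrow> 'a::euclidean_space \<Rightarrow> 'b::real_normed_vector"
  assumes lin: "\<And>p. linear (A p)" and cont: "\<And>v. continuous_on S (\<lambda>p. A p v)"
    and g: "continuous_on S g"
  shows "continuous_on S (\<lambda>p. A p (g p))"
proof -
  have "continuous_on S (\<lambda>p. \<Sum>b\<in>Basis. (g p \<bullet> b) *\<^sub>R A p b)"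
    by (intro continuous_intros g cont)
  then show ?thesis by (subst linear_eq_sum_Basis[OF lin])
qed

lemma linear_ode_unique:
  fixes A :: "real \<Rightarrow> 'a::euclidean_space \<Rightarrow> 'a"
  assumes lin: "\<And>t. linear (A t)" and cont: "\<And>v. continuous_on UNIV (\<lambda>t. A t v)"
    and u: "\<And>s. \<bar>s\<bar> \<le> \<bar>t\<bar> \<Longrightarrow> (u has_vector_derivative A s (u s) + b s) (at s)"
    and v: "\<And>s. \<bar>s\<bar> \<le> \<bar>t\<bar> \<Longrightarrow> (v has_vector_derivative A s (v s) + b s) (at s)"
    and "u 0 = v 0"
  shows "u t = v t"
proof -
  have "\<And>v. continuous_on {-\<bar>t\<bar>..\<bar>t\<bar>} (\<lambda>t. A t v)" using cont continuous_on_subset by blast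
  then obtain L where L: "0 \<le> L" "\<And>s v. s \<in> {-\<bar>t\<bar>..\<bar>t\<bar>} \<Longrightarrow> norm (A s v) \<le> L * norm v"
    using linear_family_bounded[of A "{-\<bar>t\<bar>..\<bar>t\<bar>}"] lin by (metis compact_Icc)
  have "u t - v t = 0"
  proof (rule ode_zero[where u="\<lambda>s. u s - v s" and L=L and u'="\<lambda>s. A s (u s - v s)"])
    fix s assume s: "\<bar>s\<bar> \<le> \<bar>t\<bar>"
    show "((\<lambda>s. u s - v s) has_vector_derivative A s (u s - v s)) (at s)"
      using has_vector_derivative_diff[OF u[OF s] v[OF s]] by (simp add: linear_diff[OF lin])
    show "norm (A s (u s - v s)) \<le> L * norm (u s - v s)" using s by (intro L) auto
  qed (use L assms in auto)
  then show ?thesis by simp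
qed

lemma linear_ode_exists:
  fixes A :: "real \<Rightarrow> 'a::euclidean_space \<Rightarrow> 'a"
  assumes lin: "\<And>t. linear (A t)" and cont: "\<And>v. continuous_on UNIV (\<lambda>t. A t v)"
    and contb: "continuous_on UNIV b"
  shows "\<exists>\<gamma>. \<gamma> 0 = z \<and> (\<forall>t. (\<gamma> has_vector_derivative A t (\<gamma> t) + b t) (at t))"
proof -
  (* The coefficients are unbounded, so they are held constant outside [-T, T]; the solutions for
     different T agree where they should. *)
  have ex: "\<exists>\<gamma>. \<gamma> 0 = z \<and> (\<forall>t. \<bar>t\<bar> \<le> T \<longrightarrow> (\<gamma> has_vector_derivative A t (\<gamma> t) + b t) (at t))"
    if "0 < T" for T
  proof -
    define c where "c = (\<lambda>t. max (- T) (min T t))"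
    have c: "c t \<in> {-T..T}" "\<bar>t\<bar> \<le> T \<Longrightarrow> c t = t" for t using that by (auto simp: c_def)
    have contc: "continuous_on UNIV (\<lambda>z. c (h z))" if "continuous_on UNIV h" for h :: "'z::topological_space \<Rightarrow> real"
      unfolding c_def by (intro continuous_intros that)
    have "\<And>v. continuous_on {-T..T} (\<lambda>t. A t v)" using cont continuous_on_subset by blast
    then obtain L where L: "0 \<le> L" "\<And>s v. s \<in> {-T..T} \<Longrightarrow> norm (A s v) \<le> L * norm v"
      using linear_family_bounded[of A "{-T..T}"] lin by (metis compact_Icc)
    have "compact (b ` {-T..T})"
      by (intro compact_continuous_image) (auto intro: continuous_on_subset[OF contb])
    then obtain B where B: "\<And>s. s \<in> {-T..T} \<Longrightarrow> norm (b s) \<le> B"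
      by (meson bounded_iff compact_imp_bounded imageI)
    have "\<exists>\<gamma>. \<gamma> 0 = z \<and> (\<forall>t. (\<gamma> has_vector_derivative A (c t) (\<gamma> t) + b (c t)) (at t))"
    proof (rule global_solution_lipschitz)
      have "continuous_on UNIV (\<lambda>z :: real \<times> 'a. A (c (fst z)) (snd z))"
      proof (rule linear_family_continuous[OF lin])
        show "continuous_on UNIV (\<lambda>z :: real \<times> 'a. A (c (fst z)) v)" for v
          by (rule continuous_on_compose2[OF cont contc]) (auto intro: continuous_intros)
      qed (intro continuous_intros)
      moreover have "continuous_on UNIV (\<lambda>z :: real \<times> 'a. b (c (fst z)))"
        by (rule continuous_on_compose2[OF contb contc]) (auto intro: continuous_intros)
      ultimately show "continuous_on UNIV (\<lambda>(t, y). A (c t) y + b (c t))"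
        by (simp add: case_prod_unfold continuous_on_add)
      show "norm (A (c t) u + b (c t) - (A (c t) v + b (c t))) \<le> L * norm (u - v)" for t u v
        using L(2)[OF c(1), of t "u - v"] by (simp add: linear_diff[OF lin])
      show "norm (A (c t) 0 + b (c t)) \<le> B" for t using B[OF c(1)] by (simp add: linear_0[OF lin])
    qed
    then show ?thesis using c(2) by metis
  qed
  have "\<forall>T. \<exists>\<gamma>. 0 < T \<longrightarrow> \<gamma> 0 = z \<and> (\<forall>t. \<bar>t\<bar> \<le> T \<longrightarrow> (\<gamma> has_vector_derivative A t (\<gamma> t) + b t) (at t))"
    using ex by metis
  then obtain \<gamma> where \<gamma>0: "\<And>T. 0 < T \<Longrightarrow> \<gamma> T 0 = z"
    and \<gamma>: "\<And>T t. 0 < T \<Longrightarrow> \<bar>t\<bar> \<le> T \<Longrightarrow> (\<gamma> T has_vector_derivative A t (\<gamma> T t) + b t) (at t)"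
    by metis
  define y where "y = (\<lambda>t. \<gamma> (\<bar>t\<bar> + 1) t)"
  have "(y has_vector_derivative A t (y t) + b t) (at t)" for t
  proof -
    have eq: "\<gamma> (\<bar>t\<bar> + 2) s = y s" if "\<bar>s\<bar> < \<bar>t\<bar> + 1" for s
      unfolding y_def
    proof (rule linear_ode_unique[OF lin cont, where t=s and b=b and
          u="\<gamma> (\<bar>t\<bar> + 2)" and v="\<gamma> (\<bar>s\<bar> + 1)"])
      show "(\<gamma> (\<bar>t\<bar> + 2) has_vector_derivative A r (\<gamma> (\<bar>t\<bar> + 2) r) + b r) (at r)" if "\<bar>r\<bar> \<le> \<bar>s\<bar>" for r
        using that \<open>\<bar>s\<bar> < \<bar>t\<bar> + 1\<close> by (intro \<gamma>) auto
      show "(\<gamma> (\<bar>s\<bar> + 1) has_vector_derivative A r (\<gamma> (\<bar>s\<bar> + 1) r) + b r) (at r)" if "\<bar>r\<bar> \<le> \<bar>s\<bar>" for r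
        using that by (intro \<gamma>) auto
    qed (simp add: \<gamma>0)
    have "(\<gamma> (\<bar>t\<bar> + 2) has_vector_derivative A t (\<gamma> (\<bar>t\<bar> + 2) t) + b t) (at t)"
      by (intro \<gamma>) auto
    then have "(\<gamma> (\<bar>t\<bar> + 2) has_vector_derivative A t (y t) + b t) (at t)"
      using eq[of t] by simp
    then show ?thesis
      by (rule has_vector_derivative_transform_within_open[where S="{s. \<bar>s\<bar> < \<bar>t\<bar> + 1}"])
         (auto intro!: eq open_Collect_less continuous_intros)
  qed
  moreover have "y 0 = z" by (simp add: y_def \<gamma>0)
  ultimately show ?thesis by blast
qed

subsection \<open>Dependence on parameters\<close>

text \<open>Solutions are continuous in time for free, and Gronwall's inequality gives continuity in the
  parameter uniformly on compact time intervals. Together these give joint continuity.\<close>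

lemma continuous_on_time_parameter:
  fixes y :: "real \<times> 'p::metric_space \<Rightarrow> 'a::metric_space"
  assumes time: "\<And>p. continuous_on UNIV (\<lambda>t. y (t, p))"
    and param: "\<And>p0 T \<eta>. 0 < T \<Longrightarrow> 0 < \<eta> \<Longrightarrow>
      \<exists>d>0. \<forall>p t. dist p p0 < d \<longrightarrow> \<bar>t\<bar> \<le> T \<longrightarrow> dist (y (t, p)) (y (t, p0)) < \<eta>"
  shows "continuous_on UNIV y"
  unfolding continuous_on_iff
proof (intro ballI allI impI)
  fix x :: "real \<times> 'p" and \<eta> :: real
  assume "0 < \<eta>"
  obtain t0 p0 where x: "x = (t0, p0)" by (cases x)
  have "\<exists>d>0. \<forall>p t. dist p p0 < d \<longrightarrow> \<bar>t\<bar> \<le> \<bar>t0\<bar> + 1 \<longrightarrow> dist (y (t, p)) (y (t, p0)) < \<eta> / 2"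
    by (rule param) (use \<open>0 < \<eta>\<close> in auto)
  then obtain d1 where d1: "0 < d1" "\<And>p t. dist p p0 < d1 \<Longrightarrow> \<bar>t\<bar> \<le> \<bar>t0\<bar> + 1 \<Longrightarrow> dist (y (t, p)) (y (t, p0)) < \<eta> / 2"
    by blast
  obtain d2 where d2: "0 < d2" "\<And>t. dist t t0 < d2 \<Longrightarrow> dist (y (t, p0)) (y (t0, p0)) < \<eta> / 2"
    using time[of p0] \<open>0 < \<eta>\<close> unfolding continuous_on_iff by (metis UNIV_I half_gt_zero)
  have "dist (y z) (y x) < \<eta>" if "dist z x < min (min d1 d2) 1" for z
  proof -
    obtain t p where z: "z = (t, p)" by (cases z)
    have "dist t t0 < min (min d1 d2) 1" "dist p p0 < min (min d1 d2) 1"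
      using that dist_fst_le[of z x] dist_snd_le[of z x] by (auto simp: x z)
    then have "dist (y (t, p)) (y (t, p0)) < \<eta> / 2" "dist (y (t, p0)) (y (t0, p0)) < \<eta> / 2"
      using d1(2)[of p t] d2(2)[of t] by (auto simp: dist_real_def)
    then show ?thesis
      using dist_triangle[of "y z" "y x" "y (t, p0)"] by (simp add: x z)
  qed
  then show "\<exists>d>0. \<forall>z\<in>UNIV. dist z x < d \<longrightarrow> dist (y z) (y x) < \<eta>"
    using d1 d2 by (intro exI[of _ "min (min d1 d2) 1"]) auto
qed

text \<open>The difference of two solutions satisfies the equation for one parameter up to the error made by
  inserting the solution for the other, which is small uniformly on compact time intervals.\<close>

lemma linear_ode_continuous:
  fixes A :: "real \<times> 'p::euclidean_space \<Rightarrow> 'a::euclidean_space \<Rightarrow> 'a"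
  assumes lin: "\<And>x. linear (A x)" and contA: "\<And>v. continuous_on UNIV (\<lambda>x. A x v)"
    and contb: "continuous_on UNIV b" and cont0: "continuous_on UNIV (\<lambda>p. y (0, p))"
    and y: "\<And>t p. ((\<lambda>s. y (s, p)) has_vector_derivative A (t, p) (y (t, p)) + b (t, p)) (at t)"
  shows "continuous_on UNIV y"
proof (rule continuous_on_time_parameter)
  show conty: "continuous_on UNIV (\<lambda>t. y (t, p))" for p
    using y by (meson continuous_at_imp_continuous_on has_vector_derivative_continuous)
  fix p0 :: 'p and T \<eta> :: real
  assume "0 < T" "0 < \<eta>"
  have "\<And>v. continuous_on ({-T..T} \<times> cball p0 1) (\<lambda>x. A x v)"
    using contA continuous_on_subset by blast
  then obtain L where L: "0 \<le> L" "\<And>x v. x \<in> {-T..T} \<times> cball p0 1 \<Longrightarrow> norm (A x v) \<le> L * norm v"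
    using linear_family_bounded[of A "{-T..T} \<times> cball p0 1"] lin
    by (metis compact_Icc compact_Times compact_cball)
  define E where "E = exp ((2 * L + 1) * T)"
  define e where "e = \<eta> / (2 * sqrt E)"
  have "0 < E" by (simp add: E_def)
  then have "0 < e" using \<open>0 < \<eta>\<close> by (simp add: e_def)
  define r where "r = (\<lambda>(p, t). (A (t, p) (y (t, p0)) + b (t, p)) - (A (t, p0) (y (t, p0)) + b (t, p0)))"
  have "continuous_on UNIV r"
  proof -
    have cA: "continuous_on UNIV (\<lambda>z. A (snd z, h z) (y (snd z, p0)))" if "continuous_on UNIV h"
      for h :: "'p \<times> real \<Rightarrow> 'p"
    proof (rule linear_family_continuous[OF lin])
      show "continuous_on UNIV (\<lambda>z. A (snd z, h z) v)" for v
        by (rule continuous_on_compose2[OF contA]) (auto intro!: continuous_intros that)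
      show "continuous_on UNIV (\<lambda>z :: 'p \<times> real. y (snd z, p0))"
        by (rule continuous_on_compose2[OF conty]) (auto intro!: continuous_intros)
    qed
    have cb: "continuous_on UNIV (\<lambda>z. b (snd z, h z))" if "continuous_on UNIV h"
      for h :: "'p \<times> real \<Rightarrow> 'p"
      by (rule continuous_on_compose2[OF contb]) (auto intro!: continuous_intros that)
    show ?thesis
      unfolding r_def case_prod_unfold
      by (intro continuous_on_diff continuous_on_add cA cb continuous_intros)
  qed
  then have "continuous_on (UNIV \<times> {-T..T}) r" using continuous_on_subset by blast
  then obtain X where X: "p0 \<in> X" "open X" "\<forall>p\<in>X \<inter> UNIV. \<forall>t\<in>{-T..T}. dist (r (p, t)) (r (p0, t)) \<le> e"
    using continuous_on_prod_compactE[of UNIV "{-T..T}" r p0 e] \<open>0 < e\<close> by auto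
  then obtain d1 where d1: "0 < d1" "ball p0 d1 \<subseteq> X" using openE by blast
  obtain d2 where d2: "0 < d2" "\<And>p. dist p p0 < d2 \<Longrightarrow> dist (y (0, p)) (y (0, p0)) < e"
    using cont0 \<open>0 < e\<close> unfolding continuous_on_iff by (metis UNIV_I)
  have "dist (y (t, p)) (y (t, p0)) < \<eta>" if p: "dist p p0 < min (min d1 d2) 1" and t: "\<bar>t\<bar> \<le> T" for p t
  proof -
    let ?u = "\<lambda>s. y (s, p) - y (s, p0)"
    have "(norm (?u t))\<^sup>2 \<le> ((norm (?u 0))\<^sup>2 + e\<^sup>2) * exp ((2 * L + 1) * \<bar>t\<bar>)"
    proof (rule gronwall[where u'="\<lambda>s. A (s, p) (?u s) + r (p, s)"])
      fix s assume s: "\<bar>s\<bar> \<le> \<bar>t\<bar>"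
      show "(?u has_vector_derivative A (s, p) (?u s) + r (p, s)) (at s)"
        using has_vector_derivative_diff[OF y[where t=s and p=p] y[where t=s and p=p0]]
        by (simp add: r_def linear_diff[OF lin] algebra_simps)
      have "norm (A (s, p) (?u s)) \<le> L * norm (?u s)"
        using p s t by (intro L) (auto simp: dist_commute)
      moreover have "norm (r (p, s)) \<le> e"
      proof -
        have "p \<in> X" "s \<in> {-T..T}" using p d1 s t by (auto simp: dist_commute)
        then have "dist (r (p, s)) (r (p0, s)) \<le> e" using X by blast
        then show ?thesis by (simp add: r_def)
      qed
      ultimately show "norm (A (s, p) (?u s) + r (p, s)) \<le> L * norm (?u s) + e"
        by (meson add_mono norm_triangle_ineq order_trans)
    qed (use L \<open>0 < e\<close> in auto)
    also have "\<dots> \<le> ((norm (?u 0))\<^sup>2 + e\<^sup>2) * E"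
      using t L(1) by (intro mult_left_mono) (auto simp: E_def intro: mult_left_mono)
    also have "\<dots> < (e\<^sup>2 + e\<^sup>2) * E"
      using d2(2)[of p] p \<open>0 < E\<close> by (intro mult_strict_right_mono add_strict_right_mono power_strict_mono) (auto simp: dist_norm)
    also have "\<dots> \<le> \<eta>\<^sup>2"
      using \<open>0 < E\<close> by (simp add: e_def power_divide power_mult_distrib)
    finally have "norm (?u t) < \<eta>" using \<open>0 < \<eta>\<close> by (simp add: power_less_imp_less_base)
    then show ?thesis by (simp add: dist_norm)
  qed
  then show "\<exists>d>0. \<forall>p t. dist p p0 < d \<longrightarrow> \<bar>t\<bar> \<le> T \<longrightarrow> dist (y (t, p)) (y (t, p0)) < \<eta>"
    using d1 d2 by (intro exI[of _ "min (min d1 d2) 1"]) auto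
qed

text \<open>Averaging the derivative of \<open>g\<close> over the segment from \<open>x\<close> to \<open>x + h\<close> gives Hadamard's form
  of the increment, \<open>g (x + h) - g x = mean_deriv g x h h\<close>: a difference quotient then extends
  continuously to step size zero.\<close>

definition mean_deriv ::
    "('a::real_normed_vector \<Rightarrow> 'b::euclidean_space) \<Rightarrow> 'a \<Rightarrow> 'a \<Rightarrow> 'a \<Rightarrow> 'b" where
  "mean_deriv g x h v = integral {0..1} (\<lambda>\<sigma>. frechet_derivative g (at (x + \<sigma> *\<^sub>R h)) v)"

context
  fixes g :: "'a::euclidean_space \<Rightarrow> 'b::euclidean_space"
  assumes C1: "Ck_on (Suc 0) g UNIV"
begin

lemma continuous_deriv_along_segment:
  "continuous_on S (\<lambda>z. frechet_derivative g (at (p z + q z *\<^sub>R r z)) v)"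
  if "continuous_on S p" "continuous_on S q" "continuous_on S r"
proof -
  have "continuous_on UNIV (\<lambda>x. frechet_derivative g (at x) v)" using C1 by simp
  then show ?thesis
    by (rule continuous_on_compose2) (use that in \<open>auto intro!: continuous_intros\<close>)
qed

lemma mean_deriv_linear: "linear (mean_deriv g x h)"
proof -
  note lin = has_derivative_linear[OF Ck_on_Suc_has_derivative[OF C1]]
  have int: "(\<lambda>\<sigma>. frechet_derivative g (at (x + \<sigma> *\<^sub>R h)) v) integrable_on {0..1}" for v
    by (intro integrable_continuous_real continuous_deriv_along_segment continuous_intros)
  show ?thesis
    by (rule linearI)
       (simp_all add: mean_deriv_def linear_add[OF lin] linear_scale[OF lin] integral_add[OF int int])
qed

lemma mean_deriv_0: "mean_deriv g x 0 v = frechet_derivative g (at x) v"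
  by (simp add: mean_deriv_def)

lemma mean_deriv_increment: "mean_deriv g x h h = g (x + h) - g x"
proof -
  have "((\<lambda>\<sigma>. frechet_derivative g (at (x + \<sigma> *\<^sub>R h)) h) has_integral g (x + 1 *\<^sub>R h) - g (x + 0 *\<^sub>R h)) {0..1}"
  proof (rule fundamental_theorem_of_calculus)
    fix \<sigma> :: real
    have "((\<lambda>\<sigma>. x + \<sigma> *\<^sub>R h) has_derivative (\<lambda>s. s *\<^sub>R h)) (at \<sigma>)"
      by (auto intro!: derivative_eq_intros)
    from has_derivative_compose[OF this Ck_on_Suc_has_derivative[OF C1]]
    have "((\<lambda>\<sigma>. g (x + \<sigma> *\<^sub>R h)) has_vector_derivative frechet_derivative g (at (x + \<sigma> *\<^sub>R h)) h) (at \<sigma>)"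
      using linear_scale[OF has_derivative_linear[OF Ck_on_Suc_has_derivative[OF C1]]]
      by (simp add: has_vector_derivative_def)
    then show "((\<lambda>\<sigma>. g (x + \<sigma> *\<^sub>R h)) has_vector_derivative frechet_derivative g (at (x + \<sigma> *\<^sub>R h)) h) (at \<sigma> within {0..1})"
      by (rule has_vector_derivative_at_within)
  qed simp
  then show ?thesis by (simp add: mean_deriv_def integral_unique)
qed

lemma mean_deriv_continuous:
  assumes "continuous_on UNIV p" "continuous_on UNIV q" "continuous_on UNIV r"
  shows "continuous_on UNIV (\<lambda>z. mean_deriv g (p z) (q z) (r z))"
proof (rule linear_family_continuous[OF mean_deriv_linear _ assms(3)])
  fix v
  have "continuous_on (UNIV \<times> cbox 0 1) (\<lambda>(z, \<sigma>::real). frechet_derivative g (at (p z + \<sigma> *\<^sub>R q z)) v)"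
    unfolding case_prod_unfold
    by (intro continuous_deriv_along_segment continuous_intros continuous_on_compose2[OF assms(1)]
        continuous_on_compose2[OF assms(2)]) auto
  from integral_continuous_on_param[OF this]
  show "continuous_on UNIV (\<lambda>z. mean_deriv g (p z) (q z) v)"
    by (simp add: mean_deriv_def)
qed

end

text \<open>A difference quotient \<open>Y\<close> that is jointly continuous in direction and step size converges
  uniformly on the compact unit sphere of directions.\<close>

lemma has_derivative_difference_quotient:
  fixes f :: "'p::euclidean_space \<Rightarrow> 'b::real_normed_vector"
  assumes f: "\<And>w \<tau>. f (p + \<tau> *\<^sub>R w) = f p + \<tau> *\<^sub>R Y w \<tau>"
    and cont: "continuous_on UNIV (\<lambda>(\<tau>, w). Y w \<tau>)" and lin: "linear (\<lambda>w. Y w 0)"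
  shows "(f has_derivative (\<lambda>w. Y w 0)) (at p)"
  unfolding has_derivative_at_alt
proof (intro conjI allI impI)
  show "bounded_linear (\<lambda>w. Y w 0)" using lin by (simp add: linear_conv_bounded_linear)
  fix e :: real assume "0 < e"
  have "continuous_on (UNIV \<times> sphere 0 1) (\<lambda>(\<tau>, w). Y w \<tau>)"
    using cont continuous_on_subset by blast
  then obtain X where X: "(0::real) \<in> X" "open X"
    "\<forall>\<tau>\<in>X \<inter> UNIV. \<forall>w\<in>sphere 0 1. dist (case (\<tau>, w) of (\<tau>, w) \<Rightarrow> Y w \<tau>) (case (0, w) of (\<tau>, w) \<Rightarrow> Y w \<tau>) \<le> e"
    using continuous_on_prod_compactE[of UNIV "sphere 0 1" "\<lambda>(\<tau>, w). Y w \<tau>" 0 e] \<open>0 < e\<close> by auto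
  then obtain d where d: "0 < d" "ball 0 d \<subseteq> X" using openE by blast
  have "norm (f q - f p - Y (q - p) 0) \<le> e * norm (q - p)" if "norm (q - p) < d" for q
  proof (cases "q = p")
    case True
    then show ?thesis using linear_0[OF lin] by simp
  next
    case False
    define \<tau> w where "\<tau> = norm (q - p)" and "w = (1 / norm (q - p)) *\<^sub>R (q - p)"
    have q: "q - p = \<tau> *\<^sub>R w" and w: "norm w = 1" "0 < \<tau>" using False by (auto simp: \<tau>_def w_def)
    have "\<tau> \<in> X" using that d w by (auto simp: \<tau>_def)
    then have "norm (Y w \<tau> - Y w 0) \<le> e" using X w by (auto simp: dist_norm)
    moreover have "f q = f p + \<tau> *\<^sub>R Y w \<tau>" using f[of \<tau> w] by (simp add: q[symmetric])
    then have "f q - f p - Y (q - p) 0 = \<tau> *\<^sub>R (Y w \<tau> - Y w 0)"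
      by (simp add: q linear_scale[OF lin] algebra_simps)
    ultimately show ?thesis using w by (simp add: \<tau>_def[symmetric])
  qed
  then show "\<exists>d>0. \<forall>q. norm (q - p) < d \<longrightarrow> norm (f q - f p - Y (q - p) 0) \<le> e * norm (q - p)"
    using d by blast
qed

text \<open>The difference quotient of solutions solves a linear equation whose coefficients are averaged
  derivatives of the right hand side. These coefficients are continuous in the parameter, the
  direction \<^emph>\<open>and\<close> the step size \<open>\<tau>\<close>, also at \<open>\<tau> = 0\<close>, so that continuous dependence for linear
  equations gives differentiable dependence for all equations.\<close>

lemma ode_parameter_derivative:
  fixes f :: "(real \<times> 'p::euclidean_space) \<times> 'a::euclidean_space \<Rightarrow> 'a"
  assumes f: "Ck_on (Suc 0) f UNIV" and y0: "Ck_on (Suc 0) y0 UNIV"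
    and conty: "continuous_on UNIV y" and init: "\<And>p. y (0, p) = y0 p"
    and y: "\<And>t p. ((\<lambda>s. y (s, p)) has_vector_derivative f ((t, p), y (t, p))) (at t)"
  obtains D where
    "\<And>t p. ((\<lambda>q. y (t, q)) has_derivative D (t, p)) (at p)"
    "\<And>w. continuous_on UNIV (\<lambda>x. D x w)"
    "\<And>t p w. ((\<lambda>s. D (s, p) w) has_vector_derivative
      frechet_derivative f (at ((t, p), y (t, p))) ((0, w), D (t, p) w)) (at t)"
    "\<And>p w. D (0, p) w = frechet_derivative y0 (at p) w"
proof -
  define base where "base = (\<lambda>(t, p, w :: 'p, \<tau> :: real). ((t, p), y (t, p)))"
  define inc where "inc = (\<lambda>(t, p, w :: 'p, \<tau> :: real). ((0 :: real, \<tau> *\<^sub>R w), y (t, p + \<tau> *\<^sub>R w) - y (t, p)))"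
  define A where "A = (\<lambda>x v. mean_deriv f (base x) (inc x) (0, v))"
  define b where "b = (\<lambda>x. mean_deriv f (base x) (inc x) (case x of (t, p, w, \<tau>) \<Rightarrow> ((0, w), 0)))"
  define z0 where "z0 = (\<lambda>(p, w, \<tau>). mean_deriv y0 p (\<tau> *\<^sub>R w) w)"
  note M = mean_deriv_linear[OF f]
  have contbase: "continuous_on UNIV base" and continc: "continuous_on UNIV inc"
    unfolding base_def inc_def case_prod_unfold
    by (auto intro!: continuous_intros continuous_on_compose2[OF conty])
  have linA: "linear (A x)" for x
    by (rule linearI) (simp_all add: A_def linear_add[OF M, symmetric] linear_scale[OF M, symmetric])
  have contA: "continuous_on UNIV (\<lambda>x. A x v)" for v
    unfolding A_def by (intro mean_deriv_continuous[OF f] contbase continc continuous_intros)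
  have contb: "continuous_on UNIV b"
    unfolding b_def case_prod_unfold
    by (intro mean_deriv_continuous[OF f] contbase continc continuous_intros)
  have contz0: "continuous_on UNIV z0"
    unfolding z0_def case_prod_unfold by (intro mean_deriv_continuous[OF y0] continuous_intros)
  have contAt: "continuous_on UNIV (\<lambda>t. A (t, P) v)" for P v
    by (rule continuous_on_compose2[OF contA]) (auto intro!: continuous_intros)
  have contbt: "continuous_on UNIV (\<lambda>t. b (t, P))" for P
    by (rule continuous_on_compose2[OF contb]) (auto intro!: continuous_intros)
  have "\<forall>P. \<exists>\<gamma>. \<gamma> 0 = z0 P \<and> (\<forall>t. (\<gamma> has_vector_derivative A (t, P) (\<gamma> t) + b (t, P)) (at t))"
    by (intro allI linear_ode_exists linA contAt contbt)
  then obtain \<Gamma> where \<Gamma>0: "\<And>P. \<Gamma> P 0 = z0 P"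
    and \<Gamma>: "\<And>P t. (\<Gamma> P has_vector_derivative A (t, P) (\<Gamma> P t) + b (t, P)) (at t)"
    by metis
  define Y where "Y = (\<lambda>(t, P). \<Gamma> P t)"
  have contY: "continuous_on UNIV Y"
  proof (rule linear_ode_continuous[OF linA contA contb])
    show "continuous_on UNIV (\<lambda>P. Y (0, P))" using contz0 by (simp add: Y_def \<Gamma>0)
    show "((\<lambda>s. Y (s, P)) has_vector_derivative A (t, P) (Y (t, P)) + b (t, P)) (at t)" for t P
      using \<Gamma> by (simp add: Y_def)
  qed
  have quotient: "y (t, p + \<tau> *\<^sub>R w) = y (t, p) + \<tau> *\<^sub>R Y (t, p, w, \<tau>)" for t p w \<tau>
  proof -
    let ?P = "(p, w, \<tau>)" and ?u = "\<lambda>t. y (t, p + \<tau> *\<^sub>R w) - y (t, p)"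
    have "?u t = \<tau> *\<^sub>R \<Gamma> ?P t"
    proof (rule linear_ode_unique[where A="\<lambda>t. A (t, ?P)" and b="\<lambda>t. \<tau> *\<^sub>R b (t, ?P)" and t=t
          and u="?u" and v="\<lambda>t. \<tau> *\<^sub>R \<Gamma> ?P t"])
      show "?u 0 = \<tau> *\<^sub>R \<Gamma> ?P 0"
        using linear_scale[OF mean_deriv_linear[OF y0]] mean_deriv_increment[OF y0, of p "\<tau> *\<^sub>R w"]
        by (simp add: init \<Gamma>0 z0_def)
      fix s
      have "inc (s, ?P) = (0, ?u s) + \<tau> *\<^sub>R ((0, w), 0)" by (simp add: inc_def zero_prod_def)
      then have "f (base (s, ?P) + inc (s, ?P)) - f (base (s, ?P)) = A (s, ?P) (?u s) + \<tau> *\<^sub>R b (s, ?P)"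
        unfolding A_def b_def mean_deriv_increment[OF f, symmetric]
        by (simp only: linear_add[OF M] linear_scale[OF M] prod.case)
      then show "(?u has_vector_derivative A (s, ?P) (?u s) + \<tau> *\<^sub>R b (s, ?P)) (at s)"
        using has_vector_derivative_diff[OF y[where t=s and p="p + \<tau> *\<^sub>R w"] y[where t=s and p=p]] by (simp add: base_def inc_def)
      show "((\<lambda>t. \<tau> *\<^sub>R \<Gamma> ?P t) has_vector_derivative A (s, ?P) (\<tau> *\<^sub>R \<Gamma> ?P s) + \<tau> *\<^sub>R b (s, ?P)) (at s)"
        using bounded_linear.has_vector_derivative[OF bounded_linear_scaleR_right[of \<tau>] \<Gamma>[where t=s and P="?P"]]
        by (simp add: linear_scale[OF linA] scaleR_add_right)
    qed (intro linA contAt)+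
    then show ?thesis by (simp add: Y_def algebra_simps)
  qed
  define D where "D = (\<lambda>(t, p) w. Y (t, p, w, 0))"
  have inc0: "inc (t, p, w, 0) = 0" for t p w by (simp add: inc_def zero_prod_def)
  have A0: "A (t, p, w, 0) v = frechet_derivative f (at ((t, p), y (t, p))) (0, v)"
    and b0: "b (t, p, w, 0) = frechet_derivative f (at ((t, p), y (t, p))) ((0, w), 0)" for t p w v
    unfolding A_def b_def inc0 mean_deriv_0[OF f] by (simp_all add: base_def)
  have z00: "z0 (p, w, 0) = frechet_derivative y0 (at p) w" for p w
    by (simp add: z0_def mean_deriv_0[OF y0])
  note Df = has_derivative_linear[OF Ck_on_Suc_has_derivative[OF f]]
  note Dy0 = has_derivative_linear[OF Ck_on_Suc_has_derivative[OF y0]]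
  have D0: "D (0, p) w = frechet_derivative y0 (at p) w" for p w
    by (simp add: D_def Y_def \<Gamma>0 z00)
  have DA: "((\<lambda>s. D (s, p) w) has_vector_derivative
      A (t, p, 0, 0) (D (t, p) w) + frechet_derivative f (at ((t, p), y (t, p))) ((0, w), 0)) (at t)" for t p w
    using \<Gamma>[of "(p, w, 0)" t] by (simp add: D_def Y_def A0 b0)
  have linD: "linear (D (t, p))" for t p
  proof (rule linearI)
    note unique = linear_ode_unique[where A="\<lambda>t. A (t, p, 0, 0)" and t=t, OF linA contAt]
    fix v w :: 'p and c :: real
    show "D (t, p) (v + w) = D (t, p) v + D (t, p) w"
    proof (rule unique[where u="\<lambda>s. D (s, p) (v + w)" and v="\<lambda>s. D (s, p) v + D (s, p) w", OF DA])
      fix s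
      have "((0, v + w), 0) = ((0::real, v), 0::'a) + ((0, w), 0)" by simp
      then show "((\<lambda>s. D (s, p) v + D (s, p) w) has_vector_derivative A (s, p, 0, 0) (D (s, p) v + D (s, p) w)
          + frechet_derivative f (at ((s, p), y (s, p))) ((0, v + w), 0)) (at s)"
        using has_vector_derivative_add[OF DA[where t=s and p=p and w=v] DA[where t=s and p=p and w=w]]
        by (simp only: linear_add[OF Df] linear_add[OF linA]) (simp add: algebra_simps)
    qed (simp add: D0 linear_add[OF Dy0])
    show "D (t, p) (c *\<^sub>R v) = c *\<^sub>R D (t, p) v"
    proof (rule unique[where u="\<lambda>s. D (s, p) (c *\<^sub>R v)" and v="\<lambda>s. c *\<^sub>R D (s, p) v", OF DA])
      fix s
      have "((0, c *\<^sub>R v), 0) = c *\<^sub>R ((0::real, v), 0::'a)" by simp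
      then show "((\<lambda>s. c *\<^sub>R D (s, p) v) has_vector_derivative A (s, p, 0, 0) (c *\<^sub>R D (s, p) v)
          + frechet_derivative f (at ((s, p), y (s, p))) ((0, c *\<^sub>R v), 0)) (at s)"
        using bounded_linear.has_vector_derivative[OF bounded_linear_scaleR_right[of c] DA[where t=s and p=p and w=v]]
        by (simp only: linear_scale[OF Df] linear_scale[OF linA]) (simp add: algebra_simps)
    qed (simp add: D0 linear_scale[OF Dy0])
  qed
  show thesis
  proof (rule that)
    show "((\<lambda>q. y (t, q)) has_derivative D (t, p)) (at p)" for t p
    proof -
      have "((\<lambda>q. y (t, q)) has_derivative (\<lambda>w. Y (t, p, w, 0))) (at p)"
      proof (rule has_derivative_difference_quotient[where Y="\<lambda>w \<tau>. Y (t, p, w, \<tau>)"])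
        show "continuous_on UNIV (\<lambda>(\<tau>, w). Y (t, p, w, \<tau>))"
          unfolding case_prod_unfold
          by (rule continuous_on_compose2[OF contY]) (auto intro!: continuous_intros)
        show "linear (\<lambda>w. Y (t, p, w, 0))" using linD[of t p] by (simp add: D_def)
      qed (rule quotient)
      then show ?thesis by (simp add: D_def)
    qed
    show "continuous_on UNIV (\<lambda>x. D x w)" for w
      unfolding D_def case_prod_unfold
      by (rule continuous_on_compose2[OF contY]) (auto intro!: continuous_intros)
    show "((\<lambda>s. D (s, p) w) has_vector_derivative
      frechet_derivative f (at ((t, p), y (t, p))) ((0, w), D (t, p) w)) (at t)" for t p w
    proof -
      have "((0, w), D (t, p) w) = (0, D (t, p) w) + ((0::real, w), 0)" by (simp add: zero_prod_def)
      then show ?thesis using DA[of p w t] by (simp only: linear_add[OF Df] A0)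
    qed
  qed (rule D0)
qed

text \<open>The derivative of the solution with respect to the parameter solves an equation of the same
  kind with the same parameter space, whose right hand side has one derivative less. This closes an
  induction on the order of differentiability.\<close>

theorem ode_solution_Ck:
  fixes f :: "(real \<times> 'p::euclidean_space) \<times> 'a::euclidean_space \<Rightarrow> 'a"
  assumes "Ck_on k f UNIV" "Ck_on k y0 UNIV" "continuous_on UNIV y" "\<And>p. y (0, p) = y0 p"
    and "\<And>t p. ((\<lambda>s. y (s, p)) has_vector_derivative f ((t, p), y (t, p))) (at t)"
  shows "Ck_on k y UNIV"
  using assms
proof (induction k arbitrary: f y0 y)
  case 0
  then show ?case by simp
next
  case (Suc k)
  note prems = Suc.prems
  have C1: "Ck_on (Suc 0) g UNIV" if "Ck_on (Suc k) g UNIV" for g :: "'c::euclidean_space \<Rightarrow> 'a"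
    using that Ck_on_continuous by auto
  obtain D where D:
    "\<And>t p. ((\<lambda>q. y (t, q)) has_derivative D (t, p)) (at p)"
    "\<And>w. continuous_on UNIV (\<lambda>x. D x w)"
    "\<And>t p w. ((\<lambda>s. D (s, p) w) has_vector_derivative
      frechet_derivative f (at ((t, p), y (t, p))) ((0, w), D (t, p) w)) (at t)"
    "\<And>p w. D (0, p) w = frechet_derivative y0 (at p) w"
    using ode_parameter_derivative[OF C1[OF prems(1)] C1[OF prems(2)] prems(3-5)] by blast
  have y: "Ck_on k y UNIV"
    by (rule Suc.IH[OF Ck_on_Suc_imp[OF prems(1)] Ck_on_Suc_imp[OF prems(2)] prems(3-5)])
  have pair: "Ck_on k (\<lambda>x. (x, y x)) UNIV"
    by (intro Ck_on_Pair y Ck_on_bounded_linear bounded_linear_ident)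
  have Cf: "Ck_on k (\<lambda>x. f (x, y x)) UNIV"
    by (rule Ck_on_compose[OF Ck_on_Suc_imp[OF prems(1)] pair])
  have CD: "Ck_on k (\<lambda>x. D x w) UNIV" for w
  proof -
    let ?f = "\<lambda>z :: (real \<times> 'p) \<times> 'a. frechet_derivative f (at (fst z, y (fst z))) ((0, w), snd z)"
    have "Ck_on k (\<lambda>x. frechet_derivative f (at (x, y x)) v) UNIV" for v
      by (rule Ck_on_compose[OF Ck_on_Suc_derivative[OF prems(1) Ck_on_Suc_has_derivative[OF prems(1)]] pair])
    then have Df: "Ck_on k (\<lambda>z :: (real \<times> 'p) \<times> 'a. frechet_derivative f (at (fst z, y (fst z))) v) UNIV" for v
      by (rule Ck_on_compose) (intro Ck_on_bounded_linear bounded_linear_fst)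
    have lin: "linear (frechet_derivative f (at (fst z, y (fst z))))" for z :: "(real \<times> 'p) \<times> 'a"
      by (rule has_derivative_linear[OF Ck_on_Suc_has_derivative[OF prems(1)]])
    have "Ck_on k (\<lambda>z :: (real \<times> 'p) \<times> 'a. ((0::real, w), snd z)) UNIV"
      by (intro Ck_on_Pair Ck_on_const Ck_on_bounded_linear bounded_linear_snd)
    then have f: "Ck_on k ?f UNIV"
      by (rule Ck_on_linear_apply[OF lin Df])
    have y0: "Ck_on k (\<lambda>p. frechet_derivative y0 (at p) w) UNIV" using prems(2) by simp
    show ?thesis
      by (rule Suc.IH[OF f y0 D(2) D(4)]) (use D(3) in simp)
  qed
  show ?case
    by (rule Ck_on_Suc_partials[OF prems(5) D(1) Cf CD])
qed

subsection \<open>Flows of vector fields tangent to all spheres around the origin\<close>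

lemma C1_lipschitz_on_cball:
  fixes X :: "'a::euclidean_space \<Rightarrow> 'b::euclidean_space"
  assumes X: "Ck_on (Suc 0) X UNIV"
  obtains L where "0 \<le> L" "\<And>u v. norm u \<le> R \<Longrightarrow> norm v \<le> R \<Longrightarrow> norm (X u - X v) \<le> L * norm (u - v)"
proof -
  note der = Ck_on_Suc_has_derivative[OF X]
  have "continuous_on (cball 0 R) (\<lambda>x. frechet_derivative X (at x) v)" for v
    using Ck_on_Suc_derivative[OF X der, of v] continuous_on_subset by auto
  then obtain L where L: "0 \<le> L" "\<And>x v. x \<in> cball 0 R \<Longrightarrow> norm (frechet_derivative X (at x) v) \<le> L * norm v"
    using linear_family_bounded[of "\<lambda>x. frechet_derivative X (at x)" "cball 0 R"]
      has_derivative_linear[OF der] by (metis compact_cball)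
  have "norm (X u - X v) \<le> L * norm (u - v)" if "norm u \<le> R" "norm v \<le> R" for u v
  proof (rule differentiable_bound[of "cball 0 R"])
    show "(X has_derivative frechet_derivative X (at x)) (at x within cball 0 R)" for x
      by (rule has_derivative_at_withinI[OF der])
    show "onorm (frechet_derivative X (at x)) \<le> L" if "x \<in> cball 0 R" for x
      using L that by (intro onorm_bound) auto
  qed (use that in auto)
  then show thesis using L(1) that by blast
qed

lemma closest_point_cball_origin:
  fixes y :: "'a::euclidean_space"
  assumes "0 < R" obtains c where "0 < c" "closest_point (cball 0 R) y = c *\<^sub>R y"
proof (cases "norm y \<le> R")
  case True
  then have "closest_point (cball 0 R) y = 1 *\<^sub>R y" by (simp add: closest_point_self)
  then show ?thesis using that zero_less_one by blast
next
  case False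
  let ?c = "R / norm y"
  have "0 < norm y" using False assms by linarith
  have "dist y (?c *\<^sub>R y) = norm ((1 - ?c) *\<^sub>R y)" by (simp add: dist_norm scaleR_diff_left)
  also have "\<dots> = \<bar>1 - ?c\<bar> * norm y" by simp
  also have "\<dots> = norm y - R" using False assms \<open>0 < norm y\<close> by (simp add: abs_if field_simps)
  finally have d: "dist y (?c *\<^sub>R y) = norm y - R" .
  have "?c *\<^sub>R y = closest_point (cball 0 R) y"
  proof (rule closest_point_unique)
    show "\<forall>z\<in>cball 0 R. dist y (?c *\<^sub>R y) \<le> dist y z"
    proof
      fix z :: 'a assume "z \<in> cball 0 R"
      then show "dist y (?c *\<^sub>R y) \<le> dist y z"
        unfolding d using norm_triangle_ineq2[of y z] by (simp add: dist_norm)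
    qed
  qed (use False assms in auto)
  moreover have "0 < ?c" using False assms by (intro divide_pos_pos) linarith+
  ultimately show ?thesis using that by metis
qed

context
  fixes X :: "'a::euclidean_space \<Rightarrow> 'a" and X' :: "'a \<Rightarrow> 'a \<Rightarrow> 'a"
  assumes smooth: "\<And>k. Ck_on k X UNIV"
    and tangent: "\<And>z. z \<bullet> X z = 0"
    and X': "\<And>z. (X has_derivative X' z) (at z)"
begin

lemma norm_preserved_if_orthogonal:
  fixes u :: "real \<Rightarrow> 'a"
  assumes "\<And>t. (u has_vector_derivative u' t) (at t)" "\<And>t. u t \<bullet> u' t = 0"
  shows "norm (u t) = norm (u 0)"
proof -
  have "((\<lambda>t. u t \<bullet> u t) has_real_derivative 0) (at t)" for t
  proof -
    have "((\<lambda>t. u t \<bullet> u t) has_derivative (\<lambda>h. u t \<bullet> (h *\<^sub>R u' t) + (h *\<^sub>R u' t) \<bullet> u t)) (at t)"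
      using assms(1)[of t] unfolding has_vector_derivative_def by (intro has_derivative_inner)
    moreover have "(\<lambda>h. u t \<bullet> (h *\<^sub>R u' t) + (h *\<^sub>R u' t) \<bullet> u t) = (\<lambda>h. 0)"
      using assms(2)[of t] by (auto simp: inner_commute)
    ultimately show ?thesis by (simp add: has_field_derivative_def lambda_zero)
  qed
  then have "u t \<bullet> u t = u 0 \<bullet> u 0" using DERIV_isconst_all by blast
  then show ?thesis by (simp add: norm_eq_sqrt_inner)
qed

lemma solution_exists: "\<exists>\<gamma>. \<gamma> 0 = z \<and> (\<forall>t. (\<gamma> has_vector_derivative X (\<gamma> t)) (at t))"
proof -
  (* The radial retraction to a ball makes X globally Lipschitz and keeps it tangent to spheres,
     so a solution starting inside the ball never notices the change. *)
  let ?R = "norm z + 1" and ?P = "closest_point (cball 0 (norm z + 1) :: 'a set)"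
  have R: "0 < ?R" using norm_ge_zero[of z] by linarith
  have P: "norm (?P y) \<le> ?R" for y
    using closest_point_in_set[of "cball 0 ?R" y] R by auto
  obtain L where L: "0 \<le> L" "\<And>u v. norm u \<le> ?R \<Longrightarrow> norm v \<le> ?R \<Longrightarrow> norm (X u - X v) \<le> L * norm (u - v)"
    using C1_lipschitz_on_cball[OF smooth] by blast
  have "\<exists>\<gamma>. \<gamma> 0 = z \<and> (\<forall>t. (\<gamma> has_vector_derivative X (?P (\<gamma> t))) (at t))"
  proof (rule global_solution_lipschitz)
    have "continuous_on UNIV ?P" using R by (intro continuous_on_closest_point) auto
    from continuous_on_compose2[OF Ck_on_continuous[OF smooth] this]
    have "continuous_on UNIV (\<lambda>y. X (?P y))" by simp
    from continuous_on_compose2[OF this continuous_on_snd[OF continuous_on_id]]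
    show "continuous_on UNIV (\<lambda>(t :: real, y). X (?P y))"
      by (simp add: case_prod_unfold)
    show "norm (X (?P u) - X (?P v)) \<le> L * norm (u - v)" for u v
    proof -
      have "norm (X (?P u) - X (?P v)) \<le> L * norm (?P u - ?P v)" by (intro L P)
      also have "\<dots> \<le> L * norm (u - v)"
        using closest_point_lipschitz[of "cball 0 ?R" u v] R L(1)
        by (intro mult_left_mono) (auto simp: dist_norm)
      finally show ?thesis .
    qed
    show "norm (X (?P 0)) \<le> norm (X (?P 0))" for t :: real ..
  qed
  then obtain \<gamma> where \<gamma>: "\<gamma> 0 = z" "\<And>t. (\<gamma> has_vector_derivative X (?P (\<gamma> t))) (at t)" by blast
  have "\<gamma> t \<bullet> X (?P (\<gamma> t)) = 0" for t
  proof -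
    obtain c where "0 < c" "?P (\<gamma> t) = c *\<^sub>R \<gamma> t" using closest_point_cball_origin[OF R] by blast
    then show ?thesis using tangent[of "c *\<^sub>R \<gamma> t"] by simp
  qed
  from norm_preserved_if_orthogonal[OF \<gamma>(2) this] have "norm (\<gamma> t) = norm z" for t by (simp add: \<gamma>(1))
  then have "?P (\<gamma> t) = \<gamma> t" for t by (intro closest_point_self) auto
  then show ?thesis using \<gamma> by auto
qed

lemma solution_norm:
  "(\<And>t. (u has_vector_derivative X (u t)) (at t)) \<Longrightarrow> norm (u t) = norm (u 0)"
  by (rule norm_preserved_if_orthogonal[OF _ tangent])

lemma solution_unique:
  assumes u: "\<And>t. (u has_vector_derivative X (u t)) (at t)"
    and v: "\<And>t. (v has_vector_derivative X (v t)) (at t)" and "u 0 = v 0"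
  shows "u t = v t"
proof -
  obtain L where L: "0 \<le> L" "\<And>a b. norm a \<le> norm (u 0) \<Longrightarrow> norm b \<le> norm (u 0) \<Longrightarrow> norm (X a - X b) \<le> L * norm (a - b)"
    using C1_lipschitz_on_cball[OF smooth] by blast
  have "u t - v t = 0"
  proof (rule ode_zero[where u="\<lambda>t. u t - v t" and L=L])
    show "((\<lambda>t. u t - v t) has_vector_derivative X (u s) - X (v s)) (at s)" for s
      by (intro has_vector_derivative_diff u v)
    show "norm (X (u s) - X (v s)) \<le> L * norm (u s - v s)" for s
      using solution_norm[OF u, of s] solution_norm[OF v, of s] \<open>u 0 = v 0\<close> by (intro L) auto
  qed (use L \<open>u 0 = v 0\<close> in auto)
  then show ?thesis by simp
qed

text \<open>Along with the flow \<open>\<phi>\<close> comes its spatial derivative \<open>D\<close>, which solves the equation obtained by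
  linearizing the vector field; this is what governs the pullback of differential forms.\<close>

theorem smooth_flow:
  obtains \<phi> D where
    "\<And>z. \<phi> (0, z) = z"
    "\<And>t z. ((\<lambda>s. \<phi> (s, z)) has_vector_derivative X (\<phi> (t, z))) (at t)"
    "\<And>k. Ck_on k \<phi> UNIV"
    "\<And>t z. norm (\<phi> (t, z)) = norm z"
    "\<And>s t z. \<phi> (s, \<phi> (t, z)) = \<phi> (s + t, z)"
    "\<And>t z. ((\<lambda>z. \<phi> (t, z)) has_derivative D (t, z)) (at z)"
    "\<And>z w. D (0, z) w = w"
    "\<And>t z w. ((\<lambda>s. D (s, z) w) has_vector_derivative X' (\<phi> (t, z)) (D (t, z) w)) (at t)"
proof -
  have "\<forall>z. \<exists>\<gamma>. \<gamma> 0 = z \<and> (\<forall>t. (\<gamma> has_vector_derivative X (\<gamma> t)) (at t))"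
    using solution_exists by blast
  then obtain \<Gamma> where \<Gamma>0: "\<And>z. \<Gamma> z 0 = z" and \<Gamma>: "\<And>z t. (\<Gamma> z has_vector_derivative X (\<Gamma> z t)) (at t)"
    by metis
  define \<phi> where "\<phi> = (\<lambda>(t, z). \<Gamma> z t)"
  have \<phi>0: "\<phi> (0, z) = z" for z by (simp add: \<phi>_def \<Gamma>0)
  have \<phi>: "((\<lambda>s. \<phi> (s, z)) has_vector_derivative X (\<phi> (t, z))) (at t)" for t z
    using \<Gamma> by (simp add: \<phi>_def)
  have norm_\<phi>: "norm (\<phi> (t, z)) = norm z" for t z
    using solution_norm[OF \<phi>[where z=z], of t] by (simp add: \<phi>0)
  have group: "\<phi> (s, \<phi> (t, z)) = \<phi> (s + t, z)" for s t z
  proof -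
    have "((\<lambda>s. \<phi> (s + t, z)) has_vector_derivative X (\<phi> (s + t, z))) (at s)" for s
    proof -
      have "((\<lambda>s. s + t) has_vector_derivative 1) (at s)"
        by (auto intro!: derivative_eq_intros simp flip: has_real_derivative_iff_has_vector_derivative)
      from vector_diff_chain_at[OF this \<phi>] show ?thesis by (simp add: o_def)
    qed
    from solution_unique[OF \<phi> this, of "\<phi> (t, z)"] show ?thesis by (simp add: \<phi>0)
  qed
  have cont: "continuous_on UNIV \<phi>"
  proof (rule continuous_on_time_parameter)
    show "continuous_on UNIV (\<lambda>t. \<phi> (t, p))" for p
      using \<phi> by (meson continuous_at_imp_continuous_on has_vector_derivative_continuous)
    fix p0 :: 'a and T \<eta> :: real assume "0 < T" "0 < \<eta>"
    obtain L where L: "0 \<le> L" "\<And>a b. norm a \<le> norm p0 + 1 \<Longrightarrow> norm b \<le> norm p0 + 1 \<Longrightarrow> norm (X a - X b) \<le> L * norm (a - b)"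
      using C1_lipschitz_on_cball[OF smooth] by blast
    define E where "E = exp ((2 * L + 1) * T)"
    have "0 < E" by (simp add: E_def)
    have "dist (\<phi> (t, p)) (\<phi> (t, p0)) < \<eta>" if p: "dist p p0 < min 1 (\<eta> / sqrt E)" and t: "\<bar>t\<bar> \<le> T" for p t
    proof -
      let ?u = "\<lambda>s. \<phi> (s, p) - \<phi> (s, p0)"
      have "norm p \<le> norm p0 + 1"
        using p norm_triangle_ineq2[of p p0] by (simp add: dist_norm)
      have "(norm (?u t))\<^sup>2 \<le> ((norm (?u 0))\<^sup>2 + 0\<^sup>2) * exp ((2 * L + 1) * \<bar>t\<bar>)"
      proof (rule gronwall)
        show "(?u has_vector_derivative X (\<phi> (s, p)) - X (\<phi> (s, p0))) (at s)" for s
          by (intro has_vector_derivative_diff \<phi>)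
        have "norm (X (\<phi> (s, p)) - X (\<phi> (s, p0))) \<le> L * norm (?u s)" for s
          using \<open>norm p \<le> norm p0 + 1\<close> by (intro L) (auto simp: norm_\<phi>)
        then show "norm (X (\<phi> (s, p)) - X (\<phi> (s, p0))) \<le> L * norm (?u s) + 0" for s by simp
      qed (use L in auto)
      also have "\<dots> \<le> (dist p p0)\<^sup>2 * E"
        using t L(1) by (auto simp: \<phi>0 dist_norm E_def intro!: mult_left_mono)
      also have "\<dots> < (\<eta> / sqrt E)\<^sup>2 * E"
        using p \<open>0 < E\<close> by (intro mult_strict_right_mono power_strict_mono) auto
      also have "\<dots> = \<eta>\<^sup>2" using \<open>0 < E\<close> by (simp add: power_divide)
      finally have "norm (?u t) < \<eta>" using \<open>0 < \<eta>\<close> by (simp add: power_less_imp_less_base)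
      then show ?thesis by (simp add: dist_norm)
    qed
    then show "\<exists>d>0. \<forall>p t. dist p p0 < d \<longrightarrow> \<bar>t\<bar> \<le> T \<longrightarrow> dist (\<phi> (t, p)) (\<phi> (t, p0)) < \<eta>"
      using \<open>0 < \<eta>\<close> \<open>0 < E\<close> by (intro exI[of _ "min 1 (\<eta> / sqrt E)"]) auto
  qed
  let ?f = "\<lambda>z :: (real \<times> 'a) \<times> 'a. X (snd z)"
  have f: "Ck_on k ?f UNIV" for k
    by (rule Ck_on_compose[OF smooth]) (intro Ck_on_bounded_linear bounded_linear_snd)
  have id: "Ck_on k (\<lambda>z :: 'a. z) UNIV" for k
    by (intro Ck_on_bounded_linear bounded_linear_ident)
  have ode: "((\<lambda>s. \<phi> (s, z)) has_vector_derivative ?f ((t, z), \<phi> (t, z))) (at t)" for t z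
    using \<phi> by simp
  have "Ck_on k \<phi> UNIV" for k
    by (rule ode_solution_Ck[OF f id cont \<phi>0 ode])
  moreover obtain D where D:
    "\<And>t p. ((\<lambda>q. \<phi> (t, q)) has_derivative D (t, p)) (at p)"
    "\<And>t p w. ((\<lambda>s. D (s, p) w) has_vector_derivative
      frechet_derivative ?f (at ((t, p), \<phi> (t, p))) ((0, w), D (t, p) w)) (at t)"
    "\<And>p w. D (0, p) w = frechet_derivative (\<lambda>z. z) (at p) w"
    using ode_parameter_derivative[OF f id cont \<phi>0 ode] by metis
  moreover have "frechet_derivative (\<lambda>z. z) (at p) w = w" for p w :: 'a
    using frechet_derivative_at[OF has_derivative_ident, of p] by metis
  moreover have "frechet_derivative ?f (at z) v = X' (snd z) (snd v)" for z v
  proof -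
    have "(?f has_derivative (\<lambda>v. X' (snd z) (snd v))) (at z)"
      by (rule has_derivative_compose[OF _ X']) (auto intro!: derivative_eq_intros)
    from frechet_derivative_at[OF this] show ?thesis by metis
  qed
  ultimately show thesis
    using that[of \<phi> D] \<phi>0 \<phi> norm_\<phi> group by simp
qed

end

section \<open>The standard contact sphere\<close>

definition imul :: "'n::finite space \<Rightarrow> 'n space" where
  "imul z = (\<i> * fst z, \<chi> j. \<i> * snd z $ j)"

lemma linear_imul: "linear imul"
  by (rule linearI) (auto simp: imul_def vec_eq_iff algebra_simps)

lemmas bounded_linear_imul = linear_imul[unfolded linear_conv_bounded_linear]
lemmas imul_simps = linear_add[OF linear_imul] linear_diff[OF linear_imul]
  linear_scale[OF linear_imul] linear_0[OF linear_imul] linear_neg[OF linear_imul]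

lemma imul_imul [simp]: "imul (imul z) = - z"
  by (auto simp: imul_def vec_eq_iff prod_eq_iff)

lemma inner_imul_left: "imul z \<bullet> w = - (z \<bullet> imul w)"
  by (simp add: imul_def inner_prod_def inner_vec_def inner_complex_def algebra_simps
      sum.distrib sum_subtractf sum_negf)

lemma imul_inner_imul [simp]: "imul z \<bullet> imul w = z \<bullet> w"
  by (simp add: inner_imul_left)

lemma imul_inner_self [simp]: "imul z \<bullet> z = 0" "z \<bullet> imul z = 0"
proof -
  have "imul z \<bullet> z = - (imul z \<bullet> z)" by (subst inner_imul_left) (simp add: inner_commute)
  then show "imul z \<bullet> z = 0" "z \<bullet> imul z = 0" by (auto simp: inner_commute)
qed

lemma norm_imul [simp]: "norm (imul z) = norm z"
  by (simp add: norm_eq_sqrt_inner)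

lemma liouville_eq: "liouville z v = (imul z \<bullet> v) / 2"
  by (simp add: liouville_def imul_def inner_prod_def inner_vec_def inner_complex_def
      algebra_simps sum_distrib_left add_divide_distrib diff_divide_distrib)

lemma csphere_iff: "z \<in> csphere \<longleftrightarrow> z \<bullet> z = 1 / pi"
  by (auto simp: csphere_def power2_norm_eq_inner field_simps)

lemma csphere_norm_cong: "norm z = norm w \<Longrightarrow> z \<in> csphere \<longleftrightarrow> w \<in> csphere"
  by (simp add: csphere_def)

subsection \<open>The Reeb flow\<close>

lemma ext_deriv_liouville: "ext_deriv liouville z u v = imul u \<bullet> v"
proof -
  have "((\<lambda>w. liouville w v) has_derivative (\<lambda>u. liouville u v)) (at z)" for v
    unfolding liouville_eq
    by (intro bounded_linear_imp_has_derivative bounded_linear_divide[THEN bounded_linear_compose]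
        bounded_linear_inner_left[THEN bounded_linear_compose] bounded_linear_imul)
  then have "frechet_derivative (\<lambda>w. liouville w v) (at z) u = liouville u v" for u v
    by (metis frechet_derivative_at)
  moreover have "imul v \<bullet> u = - (imul u \<bullet> v)"
    by (subst inner_imul_left) (simp add: inner_commute)
  ultimately show ?thesis by (simp add: ext_deriv_def) (simp add: liouville_eq)
qed

lemma reeb_field_eq:
  assumes "z \<in> csphere"
  shows "reeb_field z = (2 * pi) *\<^sub>R imul z"
  unfolding reeb_field_def
proof (rule the_equality)
  have z: "z \<bullet> z = 1 / pi" using assms by (simp add: csphere_iff)
  show "(2 * pi) *\<^sub>R imul z \<in> tangent z \<and> liouville z ((2 * pi) *\<^sub>R imul z) = 1 \<and>
      (\<forall>v\<in>tangent z. ext_deriv liouville z ((2 * pi) *\<^sub>R imul z) v = 0)"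
    by (simp add: tangent_def liouville_eq ext_deriv_liouville imul_simps z)
  fix r
  assume r: "r \<in> tangent z \<and> liouville z r = 1 \<and> (\<forall>v\<in>tangent z. ext_deriv liouville z r v = 0)"
  (* imul r is orthogonal to the tangent space, hence a multiple of z. *)
  let ?c = "imul r \<bullet> z / (z \<bullet> z)"
  have "z \<bullet> (imul r - ?c *\<^sub>R z) = 0"
    using z by (simp add: inner_simps inner_commute)
  then have "imul r - ?c *\<^sub>R z \<in> tangent z" by (simp only: tangent_def mem_Collect_eq)
  then have "imul r \<bullet> (imul r - ?c *\<^sub>R z) = 0"
    using r unfolding ext_deriv_liouville by blast
  with \<open>z \<bullet> (imul r - ?c *\<^sub>R z) = 0\<close> have "(imul r - ?c *\<^sub>R z) \<bullet> (imul r - ?c *\<^sub>R z) = 0"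
    by (simp add: inner_diff_left)
  then have "imul r = ?c *\<^sub>R z" by simp
  then have "imul (imul r) = imul (?c *\<^sub>R z)" by (rule arg_cong)
  then have "- r = ?c *\<^sub>R imul z" by (simp only: imul_simps imul_imul)
  then have "r = (- ?c) *\<^sub>R imul z" by (metis minus_minus scaleR_minus_left)
  then obtain c where ri: "r = c *\<^sub>R imul z" by blast
  then have "liouville z r = c / (2 * pi)" by (simp add: liouville_eq z)
  then have "c = 2 * pi" using r by (simp add: field_simps)
  then show "r = (2 * pi) *\<^sub>R imul z" using ri by simp
qed

lemma reeb_flow_eq:
  assumes z: "z \<in> csphere"
  shows "reeb_flow s z = cos (2 * pi * s) *\<^sub>R z + sin (2 * pi * s) *\<^sub>R imul z"
proof -
  let ?g = "\<lambda>s. cos (2 * pi * s) *\<^sub>R z + sin (2 * pi * s) *\<^sub>R imul z"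
  have g_sphere: "?g t \<in> csphere" for t
  proof -
    have "(a *\<^sub>R z + b *\<^sub>R imul z) \<bullet> (a *\<^sub>R z + b *\<^sub>R imul z) = (a\<^sup>2 + b\<^sup>2) * (z \<bullet> z)" for a b
      by (simp add: inner_simps power2_eq_square algebra_simps)
    then show ?thesis using z by (simp add: csphere_iff)
  qed
  have g_der: "(?g has_vector_derivative reeb_field (?g t)) (at t)" for t
    unfolding reeb_field_eq[OF g_sphere]
    by (auto intro!: derivative_eq_intros
        simp: has_vector_derivative_def imul_simps algebra_simps fun_eq_iff)
  have "(THE \<gamma>. \<gamma> 0 = z \<and> (\<forall>t. \<gamma> t \<in> csphere \<and> (\<gamma> has_vector_derivative reeb_field (\<gamma> t)) (at t))) = ?g"
  proof (rule the_equality)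
    show "?g 0 = z \<and> (\<forall>t. ?g t \<in> csphere \<and> (?g has_vector_derivative reeb_field (?g t)) (at t))"
      using g_sphere g_der by simp
    fix \<gamma> :: "real \<Rightarrow> 'a space"
    assume \<gamma>: "\<gamma> 0 = z \<and> (\<forall>t. \<gamma> t \<in> csphere \<and> (\<gamma> has_vector_derivative reeb_field (\<gamma> t)) (at t))"
    have "\<gamma> t - ?g t = 0" for t
    proof (rule ode_zero[where u="\<lambda>t. \<gamma> t - ?g t" and L="2 * pi"])
      show "((\<lambda>t. \<gamma> t - ?g t) has_vector_derivative reeb_field (\<gamma> s) - reeb_field (?g s)) (at s)" for s
        using \<gamma> g_der by (intro has_vector_derivative_diff) auto
      show "norm (reeb_field (\<gamma> s) - reeb_field (?g s)) \<le> 2 * pi * norm (\<gamma> s - ?g s)" for s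
      proof -
        have "reeb_field (\<gamma> s) - reeb_field (?g s) = (2 * pi) *\<^sub>R imul (\<gamma> s - ?g s)"
          using reeb_field_eq[OF g_sphere[of s]] reeb_field_eq[of "\<gamma> s"] \<gamma>
          by (simp only: imul_simps scaleR_diff_right)
        then show ?thesis by simp
      qed
    qed (use \<gamma> in auto)
    then show "\<gamma> = ?g" by (simp add: fun_eq_iff)
  qed
  then show ?thesis by (simp only: reeb_flow_def)
qed

subsection \<open>Derivatives along the sphere\<close>

lemma sphere_deriv_eq:
  assumes f: "(f has_derivative f') (at z)" and z: "z \<in> csphere" and v: "v \<in> tangent z"
  shows "sphere_deriv f z v = f' v"
proof (cases "v = 0")
  let ?g = "sphere_deriv f z"
  have "f differentiable (at z within csphere)"
    using f has_derivative_at_withinI differentiableI by blast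
  then have g: "(f has_derivative ?g) (at z within csphere)"
    by (simp add: sphere_deriv_def frechet_derivative_works[symmetric])
  note lin = has_derivative_linear[OF g] has_derivative_linear[OF f]
  {
    case True
    then show ?thesis by (simp add: linear_0[OF lin(1)] linear_0[OF lin(2)])
  next
    case False
    (* Both derivatives agree along the great circle through z in direction v. *)
    define r where "r = norm z / norm v"
    define c where "c = (\<lambda>t. cos t *\<^sub>R z + (sin t * r) *\<^sub>R v)"
    have "z \<noteq> 0" using z by (auto simp: csphere_def)
    then have "0 < r" using False by (simp add: r_def)
    have "c t \<in> csphere" for t
    proof -
      have "c t \<bullet> c t = (cos t)\<^sup>2 * (z \<bullet> z) + (sin t)\<^sup>2 * (r\<^sup>2 * (v \<bullet> v))"
        using v by (simp add: c_def tangent_def inner_simps inner_commute power2_eq_square algebra_simps)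
      also have "r\<^sup>2 * (v \<bullet> v) = z \<bullet> z"
        using False by (simp add: r_def power_divide flip: power2_norm_eq_inner)
      finally show ?thesis using z by (simp add: csphere_iff flip: distrib_right)
    qed
    then have "range c \<subseteq> csphere" by auto
    have c0: "c 0 = z" by (simp add: c_def)
    have c: "(c has_derivative (\<lambda>h. h *\<^sub>R (r *\<^sub>R v))) (at 0)"
      unfolding c_def by (auto intro!: derivative_eq_intros simp: fun_eq_iff)
    have "((\<lambda>t. f (c t)) has_derivative (\<lambda>h. ?g (h *\<^sub>R (r *\<^sub>R v)))) (at 0)"
      using has_derivative_in_compose[OF c, of f ?g] has_derivative_subset[OF g \<open>range c \<subseteq> csphere\<close>]
      by (simp add: c0)
    moreover have "((\<lambda>t. f (c t)) has_derivative (\<lambda>h. f' (h *\<^sub>R (r *\<^sub>R v)))) (at 0)"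
      using has_derivative_compose[OF c, of f f'] f by (simp add: c0)
    ultimately have "(\<lambda>h. ?g (h *\<^sub>R (r *\<^sub>R v))) = (\<lambda>h. f' (h *\<^sub>R (r *\<^sub>R v)))"
      by (rule has_derivative_unique)
    then have "?g (1 *\<^sub>R (r *\<^sub>R v)) = f' (1 *\<^sub>R (r *\<^sub>R v))" by metis
    then show ?thesis
      using \<open>0 < r\<close> by (simp add: linear_scale[OF lin(1)] linear_scale[OF lin(2)])
  }
qed

lemma smooth_map_onI:
  assumes "\<And>k. Ck_on k F UNIV" "\<And>x. x \<in> S \<Longrightarrow> f x = F x"
  shows "smooth_map_on S f"
  unfolding smooth_map_on_def using assms
  by (intro ballI exI[of _ UNIV] exI[of _ F]) auto

lemma norm_preserving_derivative:
  fixes h :: "'a::real_inner \<Rightarrow> 'a"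
  assumes "(h has_derivative h') (at z)" "\<And>z. norm (h z) = norm z"
  shows "h z \<bullet> h' v = z \<bullet> v"
proof -
  have "(\<lambda>z. h z \<bullet> h z) = (\<lambda>z. z \<bullet> z)" using assms(2) by (simp add: norm_eq_sqrt_inner)
  moreover have "((\<lambda>z. h z \<bullet> h z) has_derivative (\<lambda>v. h z \<bullet> h' v + h' v \<bullet> h z)) (at z)"
    by (intro has_derivative_inner assms)
  moreover have "((\<lambda>z. z \<bullet> z) has_derivative (\<lambda>v. z \<bullet> v + v \<bullet> z)) (at z)"
    by (intro has_derivative_inner has_derivative_ident)
  ultimately have "(\<lambda>v. h z \<bullet> h' v + h' v \<bullet> h z) = (\<lambda>v. z \<bullet> v + v \<bullet> z)"
    by (simp only: has_derivative_unique)
  from fun_cong[OF this, of v] show ?thesis by (simp add: inner_commute)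
qed

text \<open>For maps of the ambient space that preserve the norm, tangency is automatic, and the contact
  planes need only be mapped into contact planes by the map and by its inverse.\<close>

lemma contactomorphismI:
  fixes f g :: "'n::finite space \<Rightarrow> 'n space"
  assumes smooth: "\<And>k. Ck_on k f UNIV" "\<And>k. Ck_on k g UNIV"
    and inverse: "\<And>z. g (f z) = z" "\<And>z. f (g z) = z" and norm_f: "\<And>z. norm (f z) = norm z"
    and f': "\<And>z. (f has_derivative f' z) (at z)" and g': "\<And>z. (g has_derivative g' z) (at z)"
    and contact_f: "\<And>z v. z \<in> csphere \<Longrightarrow> z \<bullet> v = 0 \<Longrightarrow> liouville z v = 0 \<Longrightarrow> liouville (f z) (f' z v) = 0"
    and contact_g: "\<And>z v. z \<in> csphere \<Longrightarrow> z \<bullet> v = 0 \<Longrightarrow> liouville z v = 0 \<Longrightarrow> liouville (g z) (g' z v) = 0"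
  shows "contactomorphism f"
proof -
  have norm_g: "norm (g z) = norm z" for z using norm_f[of "g z"] by (simp add: inverse)
  have f_sphere: "f z \<in> csphere \<longleftrightarrow> z \<in> csphere" and g_sphere: "g z \<in> csphere \<longleftrightarrow> z \<in> csphere" for z
    using csphere_norm_cong norm_f norm_g by blast+
  have bij: "bij_betw f csphere csphere"
    by (rule bij_betw_byWitness[where f'=g]) (auto simp: inverse f_sphere g_sphere)
  have "the_inv_into csphere f z = g z" if "z \<in> csphere" for z
    using that bij by (intro the_inv_into_f_eq) (auto simp: inverse g_sphere bij_betw_def)
  then have inv: "smooth_map_on csphere (the_inv_into csphere f)"
    using smooth(2) by (intro smooth_map_onI) auto
  have "sphere_deriv f z ` contact_plane z = contact_plane (f z)" if z: "z \<in> csphere" for z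
  proof (intro equalityI subsetI)
    fix w assume "w \<in> sphere_deriv f z ` contact_plane z"
    then obtain v where v: "v \<in> tangent z" "liouville z v = 0" "w = f' z v"
      using sphere_deriv_eq[OF f' z] by (auto simp: contact_plane_def)
    then show "w \<in> contact_plane (f z)"
      using norm_preserving_derivative[OF f' norm_f, of z v] contact_f[OF z, of v]
      by (simp add: contact_plane_def tangent_def)
  next
    fix w assume w: "w \<in> contact_plane (f z)"
    let ?v = "g' (f z) w"
    have "f z \<in> csphere" using z f_sphere by simp
    then have v: "?v \<in> contact_plane z"
      using w norm_preserving_derivative[OF g' norm_g, of "f z" w] contact_g[of "f z" w]
      by (simp add: contact_plane_def tangent_def inverse)
    have "((\<lambda>x. f (g x)) has_derivative (\<lambda>u. f' z (g' (f z) u))) (at (f z))"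
      using has_derivative_compose[OF g'[of "f z"], of f "f' z"] f' by (simp add: inverse)
    moreover have "((\<lambda>x. f (g x)) has_derivative (\<lambda>u. u)) (at (f z))"
      by (simp add: inverse)
    ultimately have "(\<lambda>u. f' z (g' (f z) u)) = (\<lambda>u. u)" by (rule has_derivative_unique)
    then have "f' z ?v = w" by metis
    then have "sphere_deriv f z ?v = w"
      using sphere_deriv_eq[OF f' z, of ?v] v by (simp add: contact_plane_def)
    then show "w \<in> sphere_deriv f z ` contact_plane z" using v by (metis imageI)
  qed
  then show ?thesis
    using bij inv smooth_map_onI[of f csphere f] smooth(1) by (simp add: contactomorphism_def)
qed

subsection \<open>A unitary rotation\<close>

definition pole :: "'n::finite space" where
  "pole = (1, 0)"

definition pole2 :: "'n::finite space" where
  "pole2 = (0, axis (SOME j. True) 1)"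

lemma poles_orthonormal [simp]:
  "pole \<bullet> pole = 1" "pole2 \<bullet> pole2 = 1" "pole \<bullet> pole2 = 0" "pole2 \<bullet> pole = 0"
  "pole \<bullet> imul pole2 = 0" "pole2 \<bullet> imul pole = 0" "imul pole \<bullet> pole2 = 0" "imul pole2 \<bullet> pole = 0"
  by (simp_all add: pole_def pole2_def imul_def inner_prod_def inner_complex_def inner_axis_axis
      flip: zero_vec_def)

definition rot_gen :: "'n::finite space \<Rightarrow> 'n space" where
  "rot_gen z = (z \<bullet> pole) *\<^sub>R pole2 + (z \<bullet> imul pole) *\<^sub>R imul pole2
    - (z \<bullet> pole2) *\<^sub>R pole - (z \<bullet> imul pole2) *\<^sub>R imul pole"

text \<open>Rodrigues' formula for \<open>exp (\<theta> rot_gen)\<close>, based on \<open>rot_gen\<^sup>3 = - rot_gen\<close>.\<close>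

definition rot :: "real \<Rightarrow> 'n::finite space \<Rightarrow> 'n space" where
  "rot \<theta> z = z + sin \<theta> *\<^sub>R rot_gen z + (1 - cos \<theta>) *\<^sub>R rot_gen (rot_gen z)"

lemma linear_rot_gen: "linear rot_gen"
  by (rule linearI) (simp_all add: rot_gen_def inner_simps algebra_simps)

lemmas rot_gen_simps = linear_add[OF linear_rot_gen] linear_diff[OF linear_rot_gen]
  linear_scale[OF linear_rot_gen] linear_0[OF linear_rot_gen] linear_neg[OF linear_rot_gen]

lemma rot_gen_cube: "rot_gen (rot_gen (rot_gen z)) = - rot_gen z"
  by (simp add: rot_gen_def inner_simps algebra_simps)

lemma rot_gen_imul: "rot_gen (imul z) = imul (rot_gen z)"
  by (simp add: rot_gen_def imul_simps inner_imul_left algebra_simps)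

lemma rot_gen_skew: "rot_gen z \<bullet> w = - (z \<bullet> rot_gen w)"
  by (simp add: rot_gen_def inner_simps inner_commute algebra_simps)

lemma norm_rot_gen_le: "norm (rot_gen z) \<le> norm z"
proof -
  let ?R = "rot_gen (rot_gen z)"
  have sq: "?R \<bullet> ?R = rot_gen z \<bullet> rot_gen z" "?R \<bullet> ?R = - (?R \<bullet> z)"
    by (simp_all add: rot_gen_skew rot_gen_cube rot_gen_simps inner_commute)
  have "norm ?R * norm ?R = - (?R \<bullet> z)" using sq(2) by (simp add: dot_square_norm power2_eq_square)
  also have "\<dots> \<le> norm ?R * norm z" using norm_cauchy_schwarz[of "- ?R" z] by simp
  finally have "norm ?R \<le> norm z"
    by (metis mult_le_cancel_left_pos norm_ge_zero order_le_less)
  then show ?thesis using sq(1) by (simp add: norm_eq_sqrt_inner)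
qed

lemma linear_rot: "linear (rot \<theta>)"
  by (rule linearI) (simp_all add: rot_def rot_gen_simps algebra_simps)

lemma rot_0 [simp]: "rot 0 z = z"
  by (simp add: rot_def)

lemma rot_rot: "rot a (rot b z) = rot (a + b) z"
  by (simp add: rot_def rot_gen_simps rot_gen_cube cos_add sin_add algebra_simps)

lemma rot_imul: "rot \<theta> (imul z) = imul (rot \<theta> z)"
  by (simp add: rot_def rot_gen_imul imul_simps)

lemma inner_rot: "rot \<theta> z \<bullet> w = z \<bullet> rot (- \<theta>) w"
  by (simp add: rot_def inner_simps rot_gen_skew algebra_simps)

lemma rot_inner_rot [simp]: "rot \<theta> z \<bullet> rot \<theta> w = z \<bullet> w"
  by (simp add: inner_rot rot_rot)

lemma norm_rot [simp]: "norm (rot \<theta> z) = norm z"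
  by (simp add: norm_eq_sqrt_inner)

lemma liouville_rot [simp]: "liouville (rot \<theta> z) (rot \<theta> v) = liouville z v"
  by (simp add: liouville_eq flip: rot_imul)

lemma liouville_rot_gen_bound: "\<bar>liouville z (rot_gen z)\<bar> \<le> (z \<bullet> z) / 2"
proof -
  have "\<bar>imul z \<bullet> rot_gen z\<bar> \<le> norm (imul z) * norm (rot_gen z)" by (rule Cauchy_Schwarz_ineq2)
  also have "\<dots> \<le> norm z * norm z" using norm_rot_gen_le[of z] by (simp add: mult_left_mono)
  finally show ?thesis by (simp add: liouville_eq dot_square_norm power2_eq_square)
qed

section \<open>The squeezing flow\<close>

text \<open>The profile is a smooth approximation of \<open>c sgn y\<close>, of width \<open>d\<close>.\<close>

definition profile :: "real \<Rightarrow> real \<Rightarrow> real \<Rightarrow> real" where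
  "profile c d y = c * tanh (y / d)"

definition profile1 :: "real \<Rightarrow> real \<Rightarrow> real \<Rightarrow> real" where
  "profile1 c d y = c / d * (1 - tanh (y / d) * tanh (y / d))"

definition profile2 :: "real \<Rightarrow> real \<Rightarrow> real \<Rightarrow> real" where
  "profile2 c d y = - 2 * (c / d\<^sup>2) * tanh (y / d) * (1 - tanh (y / d) * tanh (y / d))"

text \<open>On the sphere this is the contact vector field of the contact Hamiltonian
  \<open>- profile c d (Im (fst z))\<close>: a multiple of the Reeb field plus a vector of the contact plane. Off
  the sphere it is extended so as to be tangent to all concentric spheres.\<close>

definition squeeze :: "real \<Rightarrow> real \<Rightarrow> 'n::finite space \<Rightarrow> 'n space" where
  "squeeze c d z =
     (pi * profile1 c d (z \<bullet> imul pole)) *\<^sub>R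
       ((z \<bullet> z) *\<^sub>R pole - (z \<bullet> pole) *\<^sub>R z + (z \<bullet> imul pole) *\<^sub>R imul z)
     - (2 * pi * profile c d (z \<bullet> imul pole)) *\<^sub>R imul z"

definition squeeze_deriv :: "real \<Rightarrow> real \<Rightarrow> 'n::finite space \<Rightarrow> 'n space \<Rightarrow> 'n space" where
  "squeeze_deriv c d z w =
     (pi * profile2 c d (z \<bullet> imul pole) * (w \<bullet> imul pole)) *\<^sub>R
       ((z \<bullet> z) *\<^sub>R pole - (z \<bullet> pole) *\<^sub>R z + (z \<bullet> imul pole) *\<^sub>R imul z)
     + (pi * profile1 c d (z \<bullet> imul pole)) *\<^sub>R
       ((2 * (z \<bullet> w)) *\<^sub>R pole - (w \<bullet> pole) *\<^sub>R z - (z \<bullet> pole) *\<^sub>R w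
         + (w \<bullet> imul pole) *\<^sub>R imul z + (z \<bullet> imul pole) *\<^sub>R imul w)
     - (2 * pi * profile1 c d (z \<bullet> imul pole) * (w \<bullet> imul pole)) *\<^sub>R imul z
     - (2 * pi * profile c d (z \<bullet> imul pole)) *\<^sub>R imul w"

lemma profile_has_derivative:
  assumes "d \<noteq> 0"
  shows "(profile c d has_real_derivative profile1 c d y) (at y)"
    and "(profile1 c d has_real_derivative profile2 c d y) (at y)"
  unfolding profile_def profile1_def profile2_def using assms
  by (auto intro!: derivative_eq_intros simp: power2_eq_square field_simps)

lemma abs_profile_le: "0 \<le> c \<Longrightarrow> \<bar>profile c d y\<bar> \<le> c"
  using tanh_real_bounds[of "y / d"] mult_left_mono[of "\<bar>tanh (y / d)\<bar>" 1 c]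
  by (auto simp: profile_def abs_mult)

lemma squeeze_has_derivative:
  assumes "d \<noteq> 0"
  shows "(squeeze c d has_derivative squeeze_deriv c d z) (at z)"
proof -
  have y: "((\<lambda>z. z \<bullet> imul pole) has_derivative (\<lambda>w. w \<bullet> imul pole)) (at z)"
    by (intro bounded_linear_imp_has_derivative bounded_linear_inner_left)
  have J: "(imul has_derivative imul) (at z)"
    by (intro bounded_linear_imp_has_derivative bounded_linear_imul)
  note F = has_derivative_compose[OF y profile_has_derivative(1)[OF assms, THEN has_field_derivative_imp_has_derivative]]
  note F1 = has_derivative_compose[OF y profile_has_derivative(2)[OF assms, THEN has_field_derivative_imp_has_derivative]]
  show ?thesis
    unfolding squeeze_def squeeze_deriv_def
    by (rule derivative_eq_intros F F1 J refl)+
       (simp add: fun_eq_iff algebra_simps inner_commute)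
qed

lemma squeeze_Ck: "Ck_on k (squeeze c d :: 'n::finite space \<Rightarrow> 'n space) UNIV"
proof -
  have lin: "Ck_on k (\<lambda>z :: 'n space. z \<bullet> v) UNIV" for v
    by (intro Ck_on_bounded_linear bounded_linear_inner_left)
  have J: "Ck_on k (imul :: 'n space \<Rightarrow> 'n space) UNIV" and id: "Ck_on k (\<lambda>z :: 'n space. z) UNIV"
    by (intro Ck_on_bounded_linear bounded_linear_imul bounded_linear_ident)+
  have "Ck_on k (\<lambda>z :: 'n space. (z \<bullet> imul pole) * (1 / d)) UNIV"
    by (intro Ck_on_mult lin Ck_on_const)
  from Ck_on_compose[OF Ck_on_tanh this]
  have T: "Ck_on k (\<lambda>z :: 'n space. tanh ((z \<bullet> imul pole) / d)) UNIV" by simp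
  show ?thesis
    unfolding squeeze_def profile_def profile1_def
    by (intro Ck_on_diff Ck_on_add Ck_on_scaleR Ck_on_mult Ck_on_const Ck_on_inner T J id)
qed

lemma squeeze_tangent: "z \<bullet> squeeze c d z = 0"
  by (simp add: squeeze_def inner_simps)

lemma liouville_squeeze: "liouville z (squeeze c d z) = - pi * (z \<bullet> z) * profile c d (z \<bullet> imul pole)"
  by (simp add: liouville_eq squeeze_def inner_simps inner_imul_left algebra_simps)

text \<open>The infinitesimal form of being a contact flow: along the flow the contact form is rescaled at
  the rate \<open>dH (R)\<close>, the derivative of the Hamiltonian along the Reeb field.\<close>

lemma squeeze_scales_liouville:
  assumes "z \<bullet> w = 0"
  shows "liouville (squeeze c d z) w + liouville z (squeeze_deriv c d z w)
    = - 2 * pi * profile1 c d (z \<bullet> imul pole) * (z \<bullet> pole) * liouville z w"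
proof -
  have [simp]: "imul z \<bullet> pole = - (z \<bullet> imul pole)" "imul pole \<bullet> w = w \<bullet> imul pole"
    "z \<bullet> imul w = - (imul z \<bullet> w)" "w \<bullet> z = 0" "imul z \<bullet> imul w = 0"
  proof -
    show "imul z \<bullet> pole = - (z \<bullet> imul pole)" "z \<bullet> imul w = - (imul z \<bullet> w)"
      by (simp_all add: inner_imul_left)
    show "imul pole \<bullet> w = w \<bullet> imul pole" by (rule inner_commute)
    show "w \<bullet> z = 0" "imul z \<bullet> imul w = 0" using assms by (simp_all add: inner_commute)
  qed
  show ?thesis
    by (simp add: liouville_eq squeeze_def squeeze_deriv_def inner_simps imul_simps assms algebra_simps)
       (simp add: field_simps)
qed

lemma scalar_linear_ode_proportional:
  fixes u v a :: "real \<Rightarrow> real"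
  assumes "continuous_on UNIV a"
    and u: "\<And>t. (u has_real_derivative a t * u t) (at t)"
    and v: "\<And>t. (v has_real_derivative a t * v t) (at t)"
  shows "u t * v 0 = v t * u 0"
proof (rule linear_ode_unique[where A="\<lambda>t x. a t * x" and b="\<lambda>_. 0"
      and u="\<lambda>t. u t * v 0" and v="\<lambda>t. v t * u 0" and t=t])
  show "linear (\<lambda>x. a t * x)" for t by (rule linearI) (simp_all add: algebra_simps)
  show "continuous_on UNIV (\<lambda>t. a t * x)" for x using assms(1) by (intro continuous_intros)
  show "((\<lambda>t. u t * v 0) has_vector_derivative a s * (u s * v 0) + 0) (at s)" for s
    using DERIV_cmult_right[OF u, of "v 0" s]
    by (simp add: has_real_derivative_iff_has_vector_derivative mult.assoc)
  show "((\<lambda>t. v t * u 0) has_vector_derivative a s * (v s * u 0) + 0) (at s)" for s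
    using DERIV_cmult_right[OF v, of "u 0" s]
    by (simp add: has_real_derivative_iff_has_vector_derivative mult.assoc)
qed simp

text \<open>\<open>rho\<close> vanishes exactly on the complex line of \<open>pole\<close>, which meets the sphere in a closed Reeb
  orbit; being invariant under the Reeb flow, it measures how far a whole Reeb orbit is from this one.\<close>

definition rho :: "'n::finite space \<Rightarrow> real" where
  "rho z = z \<bullet> z - (z \<bullet> pole)\<^sup>2 - (z \<bullet> imul pole)\<^sup>2"

lemma rho_eq_norm: "rho z = (norm (z - (z \<bullet> pole) *\<^sub>R pole - (z \<bullet> imul pole) *\<^sub>R imul pole))\<^sup>2"
  unfolding rho_def power2_norm_eq_inner
  by (simp add: inner_simps power2_eq_square inner_commute)

lemma rho_nonneg: "0 \<le> rho z"
  by (simp add: rho_eq_norm)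

locale squeezing_flow =
  fixes c d :: real and \<phi> :: "real \<times> 'n::finite space \<Rightarrow> 'n space"
    and D :: "real \<times> 'n space \<Rightarrow> 'n space \<Rightarrow> 'n space"
  assumes c_pos: "0 < c" and d_pos: "0 < d"
    and flow_0: "\<And>z. \<phi> (0, z) = z"
    and flow_ode: "\<And>t z. ((\<lambda>s. \<phi> (s, z)) has_vector_derivative squeeze c d (\<phi> (t, z))) (at t)"
    and flow_Ck: "\<And>k. Ck_on k \<phi> UNIV"
    and flow_norm: "\<And>t z. norm (\<phi> (t, z)) = norm z"
    and flow_flow: "\<And>s t z. \<phi> (s, \<phi> (t, z)) = \<phi> (s + t, z)"
    and flow_deriv: "\<And>t z. ((\<lambda>z. \<phi> (t, z)) has_derivative D (t, z)) (at z)"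
    and D_0: "\<And>z w. D (0, z) w = w"
    and D_ode: "\<And>t z w. ((\<lambda>s. D (s, z) w) has_vector_derivative
      squeeze_deriv c d (\<phi> (t, z)) (D (t, z) w)) (at t)"

lemma squeezing_flow_exists:
  assumes "0 < c" "0 < d"
  obtains \<phi> :: "real \<times> 'n::finite space \<Rightarrow> 'n space" and D where "squeezing_flow c d \<phi> D"
proof -
  have d: "d \<noteq> 0" using assms by simp
  obtain \<phi> :: "real \<times> 'n space \<Rightarrow> 'n space" and D where flow:
    "\<And>z. \<phi> (0, z) = z"
    "\<And>t z. ((\<lambda>s. \<phi> (s, z)) has_vector_derivative squeeze c d (\<phi> (t, z))) (at t)"
    "\<And>k. Ck_on k \<phi> UNIV"
    "\<And>t z. norm (\<phi> (t, z)) = norm z"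
    "\<And>s t z. \<phi> (s, \<phi> (t, z)) = \<phi> (s + t, z)"
    "\<And>t z. ((\<lambda>z. \<phi> (t, z)) has_derivative D (t, z)) (at z)"
    "\<And>z w. D (0, z) w = w"
    "\<And>t z w. ((\<lambda>s. D (s, z) w) has_vector_derivative squeeze_deriv c d (\<phi> (t, z)) (D (t, z) w)) (at t)"
    using smooth_flow[OF squeeze_Ck squeeze_tangent squeeze_has_derivative[OF d, of c]] by blast
  show thesis
    by (rule that, rule squeezing_flow.intro[OF assms flow])
qed

context squeezing_flow
begin

text \<open>The first coordinate of a trajectory is \<open>x + \<i> y\<close>; it evolves autonomously on the sphere, since
  \<open>rho\<close> is a function of it there.\<close>

definition x where "x z t = \<phi> (t, z) \<bullet> pole"
definition y where "y z t = \<phi> (t, z) \<bullet> imul pole"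
definition r where "r z t = rho (\<phi> (t, z))"

lemma flow_inner_self: "\<phi> (t, z) \<bullet> \<phi> (t, z) = z \<bullet> z"
  using flow_norm[of t z] by (simp add: norm_eq_sqrt_inner)

lemma r_eq: "r z t = z \<bullet> z - (x z t)\<^sup>2 - (y z t)\<^sup>2"
  by (simp add: r_def rho_def x_def y_def flow_inner_self)

lemma abs_x_le: "\<bar>x z t\<bar> \<le> norm z"
  using Cauchy_Schwarz_ineq2[of "\<phi> (t, z)" pole] by (simp add: x_def flow_norm norm_eq_sqrt_inner[of pole])

lemma flow_inner_deriv:
  "((\<lambda>t. \<phi> (t, z) \<bullet> v) has_real_derivative squeeze c d (\<phi> (t, z)) \<bullet> v) (at t)"
  using bounded_linear.has_vector_derivative[OF bounded_linear_inner_left flow_ode]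
  by (simp add: has_real_derivative_iff_has_vector_derivative)

lemma x_deriv:
  "(x z has_real_derivative pi * profile1 c d (y z t) * r z t + 2 * pi * profile c d (y z t) * y z t) (at t)"
proof -
  have "squeeze c d (\<phi> (t, z)) \<bullet> pole =
      pi * profile1 c d (y z t) * r z t + 2 * pi * profile c d (y z t) * y z t"
    by (simp add: squeeze_def inner_simps inner_imul_left r_eq x_def y_def flow_inner_self
        power2_eq_square algebra_simps)
  then show ?thesis using flow_inner_deriv[of z pole t] by (simp add: x_def[abs_def])
qed

lemma y_deriv: "(y z has_real_derivative - 2 * pi * profile c d (y z t) * x z t) (at t)"
proof -
  have "squeeze c d (\<phi> (t, z)) \<bullet> imul pole = - 2 * pi * profile c d (y z t) * x z t"
    by (simp add: squeeze_def inner_simps x_def y_def algebra_simps)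
  then show ?thesis using flow_inner_deriv[of z "imul pole" t] by (simp add: y_def[abs_def])
qed

definition rate where "rate z t = - 2 * pi * profile1 c d (y z t) * x z t"

lemma rate_continuous: "continuous_on UNIV (rate z)"
proof -
  have "continuous_on UNIV (x z)" "continuous_on UNIV (y z)"
    by (auto intro!: continuous_at_imp_continuous_on DERIV_isCont x_deriv y_deriv)
  then show ?thesis
    unfolding rate_def[abs_def] profile1_def using d_pos by (intro continuous_intros) auto
qed

lemma r_deriv: "(r z has_real_derivative rate z t * r z t) (at t)"
proof -
  have "((\<lambda>t. z \<bullet> z - (x z t)\<^sup>2 - (y z t)\<^sup>2) has_real_derivative rate z t * r z t) (at t)"
    by (rule derivative_eq_intros x_deriv y_deriv refl)+ (simp add: rate_def algebra_simps)
  then show ?thesis by (simp add: r_eq[abs_def])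
qed

lemma profile_y_deriv:
  "((\<lambda>t. profile c d (y z t)) has_real_derivative rate z t * profile c d (y z t)) (at t)"
  using DERIV_chain2[OF profile_has_derivative(1) y_deriv, of d c z t] d_pos
  by (simp add: rate_def algebra_simps)

lemma flow_tangent: "\<phi> (t, z) \<bullet> D (t, z) v = z \<bullet> v"
  by (rule norm_preserving_derivative[OF flow_deriv flow_norm])

lemma contact_form_deriv:
  assumes "z \<bullet> v = 0"
  shows "((\<lambda>t. liouville (\<phi> (t, z)) (D (t, z) v)) has_real_derivative
    rate z t * liouville (\<phi> (t, z)) (D (t, z) v)) (at t)"
proof -
  have "((\<lambda>t. imul (\<phi> (t, z)) \<bullet> D (t, z) v / 2) has_vector_derivative
     (imul (\<phi> (t, z)) \<bullet> squeeze_deriv c d (\<phi> (t, z)) (D (t, z) v)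
       + imul (squeeze c d (\<phi> (t, z))) \<bullet> D (t, z) v) / 2) (at t)"
    by (intro bounded_linear.has_vector_derivative[OF bounded_linear_divide]
        bounded_bilinear.has_vector_derivative[OF bounded_bilinear_inner]
        bounded_linear.has_vector_derivative[OF bounded_linear_imul] flow_ode D_ode)
  moreover have "\<phi> (t, z) \<bullet> D (t, z) v = 0" using assms by (simp add: flow_tangent)
  note squeeze_scales_liouville[OF this, of c d]
  ultimately show ?thesis
    by (simp add: has_real_derivative_iff_has_vector_derivative liouville_eq add_divide_distrib
        rate_def x_def y_def add.commute)
qed

lemma flow_contact:
  assumes "z \<bullet> v = 0" "liouville z v = 0" "z \<in> csphere"
  shows "liouville (\<phi> (t, z)) (D (t, z) v) = 0"
proof -
  (* The Reeb direction gives a nonzero solution to compare with. *)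
  have "z \<bullet> imul z = 0" by simp
  from scalar_linear_ode_proportional[OF rate_continuous contact_form_deriv[OF assms(1)]
      contact_form_deriv[OF this], of t]
  show ?thesis using assms by (simp add: flow_0 D_0 liouville_eq csphere_iff)
qed

text \<open>The conformal factor and \<open>rho\<close> solve the same linear equation along the flow, so they change
  by the same factor.\<close>

lemma unit_scaling_imp_rho_eq:
  assumes "z \<in> csphere" "liouville (\<phi> (t, z)) (D (t, z) (imul z)) = liouville z (imul z)"
  shows "rho (\<phi> (t, z)) = rho z"
proof -
  have "z \<bullet> imul z = 0" by simp
  from scalar_linear_ode_proportional[OF rate_continuous r_deriv contact_form_deriv[OF this], of t]
  show ?thesis using assms by (simp add: r_def flow_0 D_0 liouville_eq csphere_iff)
qed

lemma profile1_nonneg: "0 \<le> profile1 c d s"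
proof -
  have "\<bar>tanh (s / d)\<bar> \<le> 1" using tanh_real_bounds[of "s / d"] by auto
  then have "(tanh (s / d))\<^sup>2 \<le> 1" by (simp add: abs_square_le_1)
  then show ?thesis using c_pos d_pos by (simp add: profile1_def power2_eq_square)
qed

lemma sgn_profile: "sgn (profile c d s) = sgn s"
  using c_pos d_pos
  by (cases "0::real" s rule: linorder_cases)
     (auto simp: profile_def sgn_if zero_less_mult_iff zero_less_divide_iff divide_less_0_iff)

lemma profile_mult_nonneg: "0 \<le> profile c d s * s"
  using c_pos d_pos by (cases "0 \<le> s") (auto simp: profile_def divide_le_0_iff mult_nonneg_nonpos intro!: mult_nonpos_nonpos)

lemma x_mono:
  assumes "s \<le> t" shows "x z s \<le> x z t"
proof (rule DERIV_nonneg_imp_nondecreasing[OF assms])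
  fix u
  have "0 \<le> pi * (profile1 c d (y z u) * r z u)"
    unfolding r_def by (intro mult_nonneg_nonneg profile1_nonneg rho_nonneg) auto
  moreover have "0 \<le> 2 * pi * (profile c d (y z u) * y z u)"
    by (rule mult_nonneg_nonneg[OF _ profile_mult_nonneg]) simp
  ultimately have "0 \<le> pi * profile1 c d (y z u) * r z u + 2 * pi * profile c d (y z u) * y z u"
    by (simp add: mult.assoc)
  then show "\<exists>D. (x z has_real_derivative D) (at u) \<and> 0 \<le> D" using x_deriv by blast
qed

text \<open>As \<open>x\<close> increases along the flow and \<open>rho\<close> grows where \<open>x < 0\<close> and shrinks where \<open>x > 0\<close>,
  \<open>rho\<close> is unimodal in time.\<close>

lemma r_ge_if_returns:
  assumes ret: "r z 1 = r z 0" and t: "0 \<le> t" "t \<le> 1"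
  shows "r z 0 \<le> r z t"
proof (cases "x z t \<le> 0")
  case True
  show ?thesis
  proof (rule DERIV_nonneg_imp_nondecreasing[OF t(1)])
    fix s assume "s \<le> t"
    then have "0 \<le> rate z s"
      using x_mono[of s t z] True profile1_nonneg[of "y z s"] by (simp add: rate_def mult_nonneg_nonpos)
    then show "\<exists>D. (r z has_real_derivative D) (at s) \<and> 0 \<le> D"
      using r_deriv rho_nonneg by (metis mult_nonneg_nonneg r_def)
  qed
next
  case False
  have "r z 1 \<le> r z t"
  proof (rule DERIV_nonpos_imp_nonincreasing[OF t(2)])
    fix s assume "t \<le> s"
    then have "rate z s \<le> 0"
      using x_mono[of t s z] False profile1_nonneg[of "y z s"] by (simp add: rate_def mult_nonneg_nonneg)
    then show "\<exists>D. (r z has_real_derivative D) (at s) \<and> D \<le> 0"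
      using r_deriv rho_nonneg by (metis mult_nonpos_nonneg r_def)
  qed
  then show ?thesis using ret by simp
qed

text \<open>If \<open>rho\<close> returns, it stays above \<open>q\<close> for the whole unit of time. Then \<open>x\<close> grows very fast wherever
  the profile is not close to its extreme values \<open>\<plusminus> c\<close>, and where it is, the point \<open>x + \<i> y\<close> turns about
  the origin at speed at least \<open>2 pi c \<tau> > pi\<close>. But this point never crosses the axis \<open>y = 0\<close>, so it turns
  by less than \<open>pi\<close> in total, while \<open>x\<close> increases by at most \<open>2 norm z\<close>. The weight \<open>M\<close> in the sum of the
  angle and \<open>M x\<close> is so small that the second term cannot make up for the difference, and \<open>d\<close> is so
  small that the sum nevertheless grows fast enough everywhere.\<close>

lemma no_return:
  assumes \<mu>: "0 < \<mu>" "2 * c * \<tau> = 1 + \<mu>" and \<tau>: "0 < \<tau>" "\<tau> < 1"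
    and M: "0 < M" "2 * M * norm z \<le> pi * \<mu>"
    and q: "0 < q" "1 + \<mu> \<le> M * (c / d * (1 - \<tau>\<^sup>2)) * q"
    and start: "q \<le> rho z"
  shows "rho (\<phi> (1, z)) \<noteq> rho z"
proof
  assume "rho (\<phi> (1, z)) = rho z"
  then have "r z 1 = r z 0" by (simp add: r_def flow_0)
  then have r_ge: "q \<le> r z t" if "0 \<le> t" "t \<le> 1" for t
    using r_ge_if_returns[of z t] start that by (simp add: r_def flow_0)
  (* The sign of y is constant because profile c d y and rho solve the same linear equation.
     If y vanishes identically, the angle below is 0 by convention, and x alone does the work. *)
  define \<sigma> where "\<sigma> = sgn (y z 0)"
  have same_side: "sgn (y z t) = \<sigma>" if "0 \<le> t" "t \<le> 1" for t
  proof -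
    have "profile c d (y z t) * r z 0 = r z t * profile c d (y z 0)"
      by (rule scalar_linear_ode_proportional[OF rate_continuous profile_y_deriv r_deriv])
    moreover have "0 < r z t" "0 < r z 0" using r_ge[OF that] r_ge[of 0] q by auto
    ultimately show ?thesis
      unfolding \<sigma>_def by (metis mult.commute mult.right_neutral sgn_mult sgn_pos sgn_profile)
  qed
  define A where "A = (\<lambda>t. \<sigma> * arctan (x z t / y z t) + M * x z t - pi * (1 + \<mu>) * t)"
  have "A 0 \<le> A 1"
  proof (rule DERIV_nonneg_imp_nondecreasing[of 0 1 A])
    fix t :: real assume t: "0 \<le> t" "t \<le> 1"
    let ?x = "x z t" and ?y = "y z t" and ?r = "r z t"
    let ?F = "profile c d ?y" and ?F1 = "profile1 c d ?y"
    let ?dx = "pi * ?F1 * ?r + 2 * pi * ?F * ?y"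
    have r0: "0 \<le> ?r" using r_ge[OF t] q by simp
    have dx: "pi * ?F1 * ?r \<le> ?dx" using profile_mult_nonneg[of ?y] by (simp add: mult.assoc)
    have dx0: "0 \<le> pi * ?F1 * ?r" using profile1_nonneg r0 by simp
    obtain b where b: "((\<lambda>t. \<sigma> * arctan (x z t / y z t)) has_real_derivative b) (at t)"
      and b_ge: "2 * pi * \<bar>?F\<bar> \<le> b"
    proof (cases "\<sigma> = 0")
      case True
      then have "?y = 0" using same_side[OF t] by (simp add: sgn_eq_0_iff)
      then show ?thesis using True that[of 0] by (simp add: profile_def)
    next
      case False
      then have y0: "?y \<noteq> 0" using same_side[OF t] by (auto simp: \<sigma>_def)
      have \<sigma>y: "\<sigma> * ?y = \<bar>?y\<bar>" using same_side[OF t] by (simp add: abs_sgn mult.commute)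
      have \<sigma>F: "\<sigma> * ?F = \<bar>?F\<bar>"
        using same_side[OF t] sgn_profile[of ?y] by (metis abs_sgn mult.commute)
      let ?b = "\<sigma> * ((?dx * ?y - ?x * (- 2 * pi * ?F * ?x)) / (?x\<^sup>2 + ?y\<^sup>2))"
      have pos: "0 < ?x\<^sup>2 + ?y\<^sup>2" using y0 by (simp add: sum_power2_gt_zero_iff)
      have "((\<lambda>t. \<sigma> * arctan (x z t / y z t)) has_real_derivative ?b) (at t)"
      proof -
        have "((\<lambda>t. x z t / y z t) has_real_derivative
            (?dx * ?y - ?x * (- 2 * pi * ?F * ?x)) / (?y * ?y)) (at t)"
          by (rule DERIV_divide[OF x_deriv y_deriv y0])
        note DERIV_cmult[OF DERIV_chain2[OF DERIV_arctan this], of \<sigma>]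
        moreover have "inverse (1 + (?x / ?y)\<^sup>2) * (n / (?y * ?y)) = n / (?x\<^sup>2 + ?y\<^sup>2)" for n
        proof -
          have "1 + (?x / ?y)\<^sup>2 = (?x\<^sup>2 + ?y\<^sup>2) / (?y * ?y)"
            using y0 by (simp add: field_simps power2_eq_square)
          then show ?thesis using y0 by simp
        qed
        ultimately show ?thesis by (simp only:)
      qed
      moreover have "?b = (pi * ?F1 * ?r * \<bar>?y\<bar> + 2 * pi * \<bar>?F\<bar> * (?x\<^sup>2 + ?y\<^sup>2)) / (?x\<^sup>2 + ?y\<^sup>2)"
        unfolding \<sigma>y[symmetric] \<sigma>F[symmetric] by (simp add: power2_eq_square algebra_simps)
      then have "?b = 2 * pi * \<bar>?F\<bar> + pi * ?F1 * ?r * \<bar>?y\<bar> / (?x\<^sup>2 + ?y\<^sup>2)"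
        using y0 by (simp add: add_divide_distrib)
      then have "2 * pi * \<bar>?F\<bar> \<le> ?b" using dx0 pos by simp
      ultimately show ?thesis using that by blast
    qed
    have "pi * (1 + \<mu>) \<le> b + M * ?dx"
    proof (cases "\<tau> \<le> \<bar>tanh (?y / d)\<bar>")
      case True
      then have "c * \<tau> \<le> \<bar>?F\<bar>" using c_pos by (simp add: profile_def abs_mult)
      then have "pi * (1 + \<mu>) \<le> 2 * pi * \<bar>?F\<bar>" using \<mu>(2) by (simp flip: \<mu>(2))
      moreover have "0 \<le> M * ?dx" using M dx dx0 by simp
      ultimately show ?thesis using b_ge by linarith
    next
      case False
      then have "\<bar>tanh (?y / d)\<bar>\<^sup>2 \<le> \<tau>\<^sup>2" by (intro power_mono) auto
      then have "c / d * (1 - \<tau>\<^sup>2) \<le> ?F1"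
        unfolding profile1_def using c_pos d_pos
        by (intro mult_left_mono) (auto simp: power2_eq_square)
      moreover have "0 \<le> c / d * (1 - \<tau>\<^sup>2)"
        using c_pos d_pos \<tau> by (simp add: power_le_one)
      ultimately have "c / d * (1 - \<tau>\<^sup>2) * q \<le> ?F1 * ?r"
        using r_ge[OF t] q by (intro mult_mono) auto
      then have "M * (c / d * (1 - \<tau>\<^sup>2) * q) \<le> M * (?F1 * ?r)" using M by (intro mult_left_mono) auto
      then have "1 + \<mu> \<le> M * (?F1 * ?r)" using q(2) by (simp add: mult.assoc)
      then have "pi * (1 + \<mu>) \<le> pi * (M * (?F1 * ?r))" by (intro mult_left_mono) auto
      also have "\<dots> = M * (pi * ?F1 * ?r)" by simp
      also have "\<dots> \<le> M * ?dx" using dx M by (intro mult_left_mono) auto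
      finally show ?thesis using b_ge by (smt (verit) abs_ge_zero mult_nonneg_nonneg pi_ge_zero)
    qed
    moreover have "(A has_real_derivative b + M * ?dx - pi * (1 + \<mu>) * 1) (at t)"
      unfolding A_def by (intro DERIV_diff DERIV_add DERIV_cmult b x_deriv DERIV_ident)
    ultimately show "\<exists>D. (A has_real_derivative D) (at t) \<and> 0 \<le> D" by (intro exI conjI) auto
  qed simp
  moreover have "A 1 < A 0"
  proof -
    have "\<bar>\<sigma> * arctan s\<bar> < pi / 2" for s
      using arctan_lbound[of s] arctan_ubound[of s] by (auto simp: \<sigma>_def sgn_if)
    then have "\<sigma> * arctan (x z 1 / y z 1) - \<sigma> * arctan (x z 0 / y z 0) < pi"
      by (smt (verit) field_sum_of_halves)
    moreover have "M * x z 1 - M * x z 0 \<le> 2 * M * norm z"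
    proof -
      have "M * (x z 1 - x z 0) \<le> M * (2 * norm z)"
        using abs_x_le[of z 1] abs_x_le[of z 0] M by (intro mult_left_mono) auto
      then show ?thesis by (simp add: algebra_simps)
    qed
    ultimately show ?thesis using M(2) by (simp add: A_def algebra_simps)
  qed
  ultimately show False by simp
qed

end

section \<open>The contact isotopy\<close>

lemma rho_reeb_flow:
  assumes "z \<in> csphere" shows "rho (reeb_flow s z) = rho z"
proof -
  let ?a = "cos (2 * pi * s)" and ?b = "sin (2 * pi * s)"
  have ab: "?a * ?a + ?b * ?b = 1" by (simp flip: power2_eq_square)
  have "rho (a *\<^sub>R z + b *\<^sub>R imul z) = (a * a + b * b) * rho z" for a b
    by (simp add: rho_def inner_simps inner_imul_left power2_eq_square algebra_simps)
  then show ?thesis by (simp only: reeb_flow_eq[OF assms] ab mult_1)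
qed

text \<open>Near the complex line of \<open>pole\<close> the component along \<open>pole2\<close> is small, but the rotation makes it
  about \<open>sin \<theta>\<close> times the component along \<open>pole\<close>, which is almost all of the vector.\<close>

lemma rho_rot_disjoint:
  fixes w :: "'n::finite space"
  assumes q: "5 * q = (sin \<theta>)\<^sup>2 * (w \<bullet> w)" and w: "rho w < q" "rho (rot \<theta> w) < q"
  shows False
proof -
  have comp: "(u \<bullet> pole2)\<^sup>2 + (u \<bullet> imul pole2)\<^sup>2 \<le> rho u" for u :: "'n space"
  proof -
    let ?v = "u - (u \<bullet> pole) *\<^sub>R pole - (u \<bullet> imul pole) *\<^sub>R imul pole"
    have "0 \<le> (norm (?v - (u \<bullet> pole2) *\<^sub>R pole2 - (u \<bullet> imul pole2) *\<^sub>R imul pole2))\<^sup>2" by simp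
    also have "\<dots> = rho u - (u \<bullet> pole2)\<^sup>2 - (u \<bullet> imul pole2)\<^sup>2"
      unfolding power2_norm_eq_inner rho_def
      by (simp add: inner_simps inner_commute power2_eq_square)
    finally show ?thesis by simp
  qed
  have rot_pole2: "rot (- \<theta>) pole2 = sin \<theta> *\<^sub>R pole + cos \<theta> *\<^sub>R pole2"
    by (simp add: rot_def rot_gen_def inner_simps algebra_simps)
  define x y a b where "x = w \<bullet> pole" and "y = w \<bullet> imul pole"
    and "a = w \<bullet> pole2" and "b = w \<bullet> imul pole2"
  note coords = x_def y_def a_def b_def
  let ?s = "sin \<theta>" and ?c = "cos \<theta>"
  have A: "rot \<theta> w \<bullet> pole2 = ?s * x + ?c * a"
    by (simp add: inner_rot rot_pole2 inner_simps coords)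
  have B: "rot \<theta> w \<bullet> imul pole2 = ?s * y + ?c * b"
    by (simp add: inner_rot rot_imul rot_pole2 imul_simps inner_simps coords)
  have sq: "(s * u)\<^sup>2 \<le> 2 * (s * u + k * v)\<^sup>2 + 2 * v\<^sup>2" if "k\<^sup>2 \<le> 1" for s k u v :: real
  proof -
    have "k\<^sup>2 * v\<^sup>2 \<le> 1 * v\<^sup>2" using that by (intro mult_right_mono) auto
    moreover have "0 \<le> (s * u + 2 * (k * v))\<^sup>2" by simp
    ultimately show ?thesis by (simp add: power2_eq_square algebra_simps)
  qed
  have c1: "?c\<^sup>2 \<le> 1" by (simp add: abs_square_le_1)
  have s1: "?s\<^sup>2 \<le> 1" by (simp add: abs_square_le_1)
  have "?s\<^sup>2 * (x\<^sup>2 + y\<^sup>2) = (?s * x)\<^sup>2 + (?s * y)\<^sup>2" by (simp add: power_mult_distrib algebra_simps)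
  also have "\<dots> \<le> 2 * ((?s * x + ?c * a)\<^sup>2 + (?s * y + ?c * b)\<^sup>2) + 2 * (a\<^sup>2 + b\<^sup>2)"
    using sq[OF c1, of ?s x a] sq[OF c1, of ?s y b] by simp
  also have "\<dots> \<le> 2 * rho (rot \<theta> w) + 2 * rho w"
    using comp[of "rot \<theta> w"] comp[of w] by (simp add: A B flip: coords)
  also have "\<dots> < 4 * q" using w by simp
  finally have "?s\<^sup>2 * (x\<^sup>2 + y\<^sup>2) < 4 * q" .
  moreover have "w \<bullet> w - q < x\<^sup>2 + y\<^sup>2" using w(1) by (simp add: rho_def coords)
  then have "?s\<^sup>2 * (w \<bullet> w - q) \<le> ?s\<^sup>2 * (x\<^sup>2 + y\<^sup>2)" by (intro mult_left_mono) auto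
  moreover have "0 < q" using w(1) rho_nonneg[of w] by linarith
  then have "?s\<^sup>2 * q \<le> 1 * q" using s1 by (intro mult_right_mono) auto
  ultimately show False using q by (simp add: algebra_simps)
qed

context squeezing_flow
begin

definition isotopy :: "real \<Rightarrow> real \<Rightarrow> 'n space \<Rightarrow> 'n space" where
  "isotopy \<theta> t z = rot (\<theta> * t) (\<phi> (t, z))"

lemma isotopy_0 [simp]: "isotopy \<theta> 0 z = z"
  by (simp add: isotopy_def flow_0)

lemma isotopy_Ck: "Ck_on k (\<lambda>x. isotopy \<theta> (fst x) (snd x)) UNIV"
proof -
  have lin: "Ck_on k h UNIV" if "linear h" for h :: "'n space \<Rightarrow> 'n space"
    using that by (simp add: Ck_on_bounded_linear linear_conv_bounded_linear)
  note Q = lin[OF linear_rot_gen]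
  have angle: "Ck_on k (\<lambda>x :: real \<times> 'n space. \<theta> * fst x) UNIV"
    by (intro Ck_on_mult Ck_on_const Ck_on_bounded_linear bounded_linear_fst)
  note sin = Ck_on_compose[OF Ck_on_sin_cos[THEN conjunct1] angle]
    and cos = Ck_on_compose[OF Ck_on_sin_cos[THEN conjunct2] angle]
  note \<phi> = flow_Ck[of k] and Q\<phi> = Ck_on_compose[OF Q flow_Ck]
  show ?thesis
    unfolding isotopy_def rot_def prod.collapse
    by (intro Ck_on_add Ck_on_scaleR Ck_on_diff Ck_on_const \<phi> Q\<phi> sin cos Ck_on_compose[OF Q Q\<phi>])
qed

lemma isotopy_smooth:
  fixes \<tau> :: "'s::euclidean_space \<Rightarrow> real" and p :: "'s \<Rightarrow> 'n space"
  assumes "Ck_on k \<tau> UNIV" "Ck_on k p UNIV"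
  shows "Ck_on k (\<lambda>s. isotopy \<theta> (\<tau> s) (p s)) UNIV"
  using Ck_on_compose[OF isotopy_Ck Ck_on_Pair[OF assms]] by simp

lemma isotopy_has_derivative:
  "(isotopy \<theta> t has_derivative (\<lambda>v. rot (\<theta> * t) (D (t, z) v))) (at z)"
  unfolding isotopy_def[abs_def]
  using bounded_linear.has_derivative[OF linear_rot[unfolded linear_conv_bounded_linear] flow_deriv] .

lemma isotopy_contactomorphism: "contactomorphism (isotopy \<theta> t)"
proof (rule contactomorphismI)
  let ?R = "rot (- (\<theta> * t)) :: 'n space \<Rightarrow> 'n space"
  have bl: "bounded_linear ?R" using linear_rot linear_conv_bounded_linear by blast
  show "Ck_on k (isotopy \<theta> t) UNIV" for k
    using isotopy_smooth[OF Ck_on_const Ck_on_bounded_linear[OF bounded_linear_ident]] .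
  show "Ck_on k (\<lambda>z. \<phi> (- t, ?R z)) UNIV" for k
    by (rule Ck_on_compose[OF flow_Ck]) (intro Ck_on_Pair Ck_on_const Ck_on_bounded_linear bl)
  show "\<phi> (- t, ?R (isotopy \<theta> t z)) = z" "isotopy \<theta> t (\<phi> (- t, ?R z)) = z" for z
    by (simp_all add: isotopy_def rot_rot flow_flow flow_0)
  show "norm (isotopy \<theta> t z) = norm z" for z by (simp add: isotopy_def flow_norm)
  show "(isotopy \<theta> t has_derivative (\<lambda>v. rot (\<theta> * t) (D (t, z) v))) (at z)" for z
    by (rule isotopy_has_derivative)
  show "((\<lambda>z. \<phi> (- t, ?R z)) has_derivative (\<lambda>v. D (- t, ?R z) (?R v))) (at z)" for z
    by (rule has_derivative_compose[OF bounded_linear_imp_has_derivative[OF bl] flow_deriv])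
  fix z v :: "'n space"
  assume *: "z \<in> csphere" "z \<bullet> v = 0" "liouville z v = 0"
  show "liouville (isotopy \<theta> t z) (rot (\<theta> * t) (D (t, z) v)) = 0"
    using flow_contact[of z v t] * by (simp add: isotopy_def)
  have "?R z \<in> csphere" using *(1) csphere_norm_cong[of "?R z" z] by simp
  then show "liouville (\<phi> (- t, ?R z)) (D (- t, ?R z) (?R v)) = 0"
    using flow_contact[of "?R z" "?R v"] * by simp
qed

lemma isotopy_contact_isotopy: "contact_isotopy (isotopy \<theta>)"
proof -
  have "smooth_map_on ({0..1} \<times> csphere) (\<lambda>(t, z). isotopy \<theta> t z)"
    by (rule smooth_map_onI[OF isotopy_Ck]) auto
  then show ?thesis using isotopy_contactomorphism by (simp add: contact_isotopy_def)
qed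

subsection \<open>Absence of translated points\<close>

lemma isotopy_no_translated_points:
  assumes no_ret: "\<And>z. z \<in> csphere \<Longrightarrow> q \<le> rho z \<Longrightarrow> rho (\<phi> (1, z)) \<noteq> rho z"
    and q: "5 * q = (sin \<theta>)\<^sup>2 / pi"
  shows "translated_points (isotopy \<theta> 1) = {}"
proof -
  have small: "rho z < q \<and> rho (\<phi> (1, z)) = rho z \<and> z \<in> csphere"
    if "z \<in> unit_scaling_set (isotopy \<theta> 1)" for z
  proof -
    have z: "z \<in> csphere" using that by (simp add: unit_scaling_set_def)
    have "imul z \<in> tangent z" by (simp add: tangent_def)
    then have "liouville (isotopy \<theta> 1 z) (sphere_deriv (isotopy \<theta> 1) z (imul z)) = liouville z (imul z)"
      "sphere_deriv (isotopy \<theta> 1) z (imul z) = rot (\<theta> * 1) (D (1, z) (imul z))"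
      using that sphere_deriv_eq[OF isotopy_has_derivative z] by (auto simp: unit_scaling_set_def)
    then have "liouville (\<phi> (1, z)) (D (1, z) (imul z)) = liouville z (imul z)"
      by (simp add: isotopy_def)
    then have "rho (\<phi> (1, z)) = rho z" by (rule unit_scaling_imp_rho_eq[OF z])
    then show ?thesis using no_ret[OF z] z by force
  qed
  have False if "z \<in> unit_scaling_set (isotopy \<theta> 1)"
    "reeb_flow s z = isotopy \<theta> 1 z'" "z' \<in> unit_scaling_set (isotopy \<theta> 1)" for z s z'
  proof (rule rho_rot_disjoint)
    let ?w = "\<phi> (1, z')"
    show "rho ?w < q" using small[OF that(3)] by simp
    have "rot \<theta> ?w = reeb_flow s z" using that(2) by (simp add: isotopy_def)
    then show "rho (rot \<theta> ?w) < q" using small[OF that(1)] by (simp add: rho_reeb_flow)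
    show "5 * q = (sin \<theta>)\<^sup>2 * (?w \<bullet> ?w)"
      using q small[OF that(3)] by (simp add: flow_inner_self csphere_iff)
  qed
  then show ?thesis by (auto simp: translated_points_def)
qed

subsection \<open>Distance to the identity\<close>

lemma isotopy_time_derivative:
  "((\<lambda>t. isotopy \<theta> t z) has_vector_derivative
     \<theta> *\<^sub>R rot_gen (isotopy \<theta> t z) + rot (\<theta> * t) (squeeze c d (\<phi> (t, z)))) (at t)"
proof -
  note Q = linear_rot_gen[unfolded linear_conv_bounded_linear]
  have \<phi>: "((\<lambda>t. \<phi> (t, z)) has_derivative (\<lambda>h. h *\<^sub>R squeeze c d (\<phi> (t, z)))) (at t)"
    using flow_ode by (simp add: has_vector_derivative_def)
  note Q\<phi> = bounded_linear.has_derivative[OF Q \<phi>]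
  note QQ\<phi> = bounded_linear.has_derivative[OF Q Q\<phi>]
  show ?thesis
    unfolding isotopy_def rot_def has_vector_derivative_def
    by (rule derivative_eq_intros \<phi> Q\<phi> QQ\<phi> refl)+
       (simp add: rot_gen_simps rot_gen_cube fun_eq_iff algebra_simps)
qed

lemma liouville_isotopy_derivative_le:
  assumes "z \<in> csphere"
  shows "\<bar>liouville (isotopy \<theta> t z) (\<theta> *\<^sub>R rot_gen (isotopy \<theta> t z) + rot (\<theta> * t) (squeeze c d (\<phi> (t, z))))\<bar>
    \<le> c + \<bar>\<theta>\<bar> / (2 * pi)"
proof -
  let ?z = "isotopy \<theta> t z" and ?w = "\<phi> (t, z)"
  have norm: "?z \<bullet> ?z = 1 / pi" "?w \<bullet> ?w = 1 / pi"
    using assms by (simp_all add: isotopy_def flow_inner_self csphere_iff)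
  have "liouville ?z (\<theta> *\<^sub>R rot_gen ?z + rot (\<theta> * t) (squeeze c d ?w))
    = \<theta> * liouville ?z (rot_gen ?z) + liouville ?z (rot (\<theta> * t) (squeeze c d ?w))"
    by (simp add: liouville_eq inner_simps add_divide_distrib)
  also have "liouville ?z (rot (\<theta> * t) (squeeze c d ?w)) = - profile c d (?w \<bullet> imul pole)"
    by (simp add: isotopy_def liouville_squeeze norm)
  finally have "\<bar>liouville ?z (\<theta> *\<^sub>R rot_gen ?z + rot (\<theta> * t) (squeeze c d ?w))\<bar>
      \<le> \<bar>\<theta>\<bar> * \<bar>liouville ?z (rot_gen ?z)\<bar> + \<bar>profile c d (?w \<bullet> imul pole)\<bar>"
    by (simp flip: abs_mult)
  also have "\<dots> \<le> \<bar>\<theta>\<bar> * (1 / pi / 2) + c"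
    using liouville_rot_gen_bound[of ?z] abs_profile_le[of c d] c_pos
    by (intro add_mono mult_left_mono) (auto simp: norm)
  finally show ?thesis by (simp add: field_simps)
qed

text \<open>Running the isotopy for a shorter and shorter time is a square from it to the constant
  isotopy, whose length is the time integral of the contact Hamiltonian.\<close>

lemma hofer_dist_isotopy_le:
  "hofer_dist (isotopy \<theta>) (\<lambda>t. reeb_flow (t * 0)) \<le> ennreal (c + \<bar>\<theta>\<bar> / (2 * pi))"
proof -
  let ?K = "c + \<bar>\<theta>\<bar> / (2 * pi)"
  let ?\<Psi> = "\<lambda>s t z. isotopy \<theta> (t * (1 - s)) z"
  have "Ck_on k (\<lambda>x :: real \<times> real \<times> 'n space. isotopy \<theta> (fst (snd x) * (1 - fst x)) (snd (snd x))) UNIV" for k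
    by (intro isotopy_smooth Ck_on_mult Ck_on_diff Ck_on_const Ck_on_bounded_linear
        bounded_linear_fst_comp bounded_linear_snd_comp bounded_linear_ident)
  then have "smooth_map_on ({0..1} \<times> {0..1} \<times> csphere) (\<lambda>(s, t, z). ?\<Psi> s t z)"
    by (rule smooth_map_onI) auto
  then have "?\<Psi> \<in> isotopy_squares (isotopy \<theta>) (\<lambda>t. reeb_flow (t * 0))"
    using isotopy_contactomorphism by (auto simp: isotopy_squares_def reeb_flow_eq)
  then have "hofer_dist (isotopy \<theta>) (\<lambda>t. reeb_flow (t * 0)) \<le> hofer_length (\<lambda>s. ?\<Psi> s 1)"
    unfolding hofer_dist_def by (rule INF_lower)
  also have "\<dots> \<le> (\<integral>\<^sup>+s\<in>{0..1::real}. ennreal ?K \<partial>lborel)"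
    unfolding hofer_length_def
  proof (rule nn_integral_mono)
    fix s :: real
    have "(SUP z\<in>csphere. ennreal \<bar>liouville (?\<Psi> s 1 z) (vector_derivative (\<lambda>r. ?\<Psi> r 1 z) (at s within {0..1}))\<bar>)
        \<le> ennreal ?K" if s: "s \<in> {0..1}"
    proof (rule SUP_least)
      fix z :: "'n space" assume z: "z \<in> csphere"
      let ?v = "\<theta> *\<^sub>R rot_gen (isotopy \<theta> (1 - s) z) + rot (\<theta> * (1 - s)) (squeeze c d (\<phi> (1 - s, z)))"
      have "((\<lambda>r. 1 - r) has_vector_derivative - 1) (at s)"
        by (auto intro!: derivative_eq_intros simp flip: has_real_derivative_iff_has_vector_derivative)
      from vector_diff_chain_at[OF this isotopy_time_derivative]
      have "((\<lambda>r. ?\<Psi> r 1 z) has_vector_derivative - ?v) (at s)"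
        by (simp add: o_def)
      then have "vector_derivative (\<lambda>r. ?\<Psi> r 1 z) (at s within {0..1}) = - ?v"
        using s by (intro vector_derivative_at_within_ivl) auto
      moreover have "liouville (?\<Psi> s 1 z) (- ?v) = - liouville (isotopy \<theta> (1 - s) z) ?v"
        by (simp only: liouville_eq inner_minus_right mult_1 minus_divide_left)
      ultimately show "ennreal \<bar>liouville (?\<Psi> s 1 z) (vector_derivative (\<lambda>r. ?\<Psi> r 1 z) (at s within {0..1}))\<bar> \<le> ennreal ?K"
        using liouville_isotopy_derivative_le[OF z, of \<theta> "1 - s"] by (simp only: abs_minus_cancel ennreal_leI)
    qed
    then show "(SUP z\<in>csphere. ennreal \<bar>liouville (?\<Psi> s 1 z) (vector_derivative (\<lambda>r. ?\<Psi> r 1 z) (at s within {0..1}))\<bar>)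
        * indicator {0..1} s \<le> ennreal ?K * indicator {0..1} s"
      by (cases "s \<in> {0..1}") auto
  qed
  also have "\<dots> = ennreal ?K" by (simp add: nn_integral_cmult_indicator)
  finally show ?thesis .
qed

end

theorem theorem1:
  fixes \<epsilon> :: real
  assumes "\<epsilon> > 0"
  shows "\<exists>\<psi> :: real \<Rightarrow> 'n::finite space \<Rightarrow> 'n space.
    contact_isotopy \<psi> \<and>
    translated_points (\<psi> 1) = {} \<and>
    2 * (INF s::real. hofer_dist \<psi> (\<lambda>t. reeb_flow (t * s))) < ennreal (1 + \<epsilon>)"
proof -
  (* \<mu> > 0 leaves room between the angle 2 pi c \<tau> turned in unit time and the available angle pi;
     M makes the total change of M x at most pi \<mu>, and d is chosen last. *)
  define c where "c = 1 / 2 + \<epsilon> / 8"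
  define \<mu> where "\<mu> = \<epsilon> / 8"
  define \<tau> where "\<tau> = (1 + \<mu>) / (2 * c)"
  define \<theta> where "\<theta> = min 1 (\<epsilon> / 2)"
  define q where "q = (sin \<theta>)\<^sup>2 / (5 * pi)"
  define M where "M = pi * \<mu> / (2 * sqrt (1 / pi))"
  define d where "d = M * c * (1 - \<tau>\<^sup>2) * q / (1 + \<mu>)"
  have c: "0 < c" and \<mu>: "0 < \<mu>" "2 * c * \<tau> = 1 + \<mu>" and \<tau>: "0 < \<tau>" "\<tau> < 1"
    using assms by (auto simp: c_def \<mu>_def \<tau>_def field_simps)
  have M: "0 < M" "2 * M * sqrt (1 / pi) = pi * \<mu>" using \<mu> by (auto simp: M_def)
  have \<theta>: "0 < \<theta>" "\<theta> \<le> 1" "\<theta> \<le> \<epsilon> / 2" using assms by (auto simp: \<theta>_def)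
  have "0 < sin \<theta>" using \<theta> pi_gt3 by (intro sin_gt_zero) linarith+
  then have q: "0 < q" "5 * q = (sin \<theta>)\<^sup>2 / pi" by (simp_all add: q_def)
  have "\<tau>\<^sup>2 < 1" using \<tau> by (simp add: abs_square_less_1)
  then have d: "0 < d" "M * (c / d * (1 - \<tau>\<^sup>2)) * q = 1 + \<mu>"
    using M c q \<mu> by (simp_all add: d_def)
  obtain \<phi> :: "real \<times> 'n space \<Rightarrow> 'n space" and D where "squeezing_flow c d \<phi> D"
    using squeezing_flow_exists[OF c d(1)] by blast
  then interpret squeezing_flow c d \<phi> D .
  have "rho (\<phi> (1, z)) \<noteq> rho z" if "z \<in> csphere" "q \<le> rho z" for z
  proof (rule no_return[OF \<mu> \<tau> M(1) _ q(1) _ that(2)])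
    have "norm z = sqrt (1 / pi)" using that(1) by (simp add: norm_eq_sqrt_inner csphere_iff)
    then show "2 * M * norm z \<le> pi * \<mu>" using M by simp
  qed (use d in simp)
  then have "translated_points (isotopy \<theta> 1) = {}"
    by (rule isotopy_no_translated_points[OF _ q(2)])
  moreover have "2 * (INF s::real. hofer_dist (isotopy \<theta>) (\<lambda>t. reeb_flow (t * s))) < ennreal (1 + \<epsilon>)"
  proof -
    have "(INF s::real. hofer_dist (isotopy \<theta>) (\<lambda>t. reeb_flow (t * s))) \<le> ennreal (c + \<bar>\<theta>\<bar> / (2 * pi))"
      using hofer_dist_isotopy_le by (intro INF_lower2[of 0]) auto
    then have "2 * (INF s::real. hofer_dist (isotopy \<theta>) (\<lambda>t. reeb_flow (t * s)))
        \<le> ennreal 2 * ennreal (c + \<bar>\<theta>\<bar> / (2 * pi))"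
      by (intro mult_mono) auto
    also have "\<dots> = ennreal (2 * (c + \<bar>\<theta>\<bar> / (2 * pi)))"
      by (rule ennreal_mult'[symmetric]) simp
    also have "2 * (c + \<bar>\<theta>\<bar> / (2 * pi)) = 2 * c + \<theta> / pi"
      using \<theta> by (simp add: field_simps)
    also have "ennreal (2 * c + \<theta> / pi) < ennreal (1 + \<epsilon>)"
    proof (rule ennreal_lessI)
      have "\<theta> / pi \<le> \<theta> / 1" using \<theta> pi_gt3 by (intro divide_left_mono) auto
      then show "2 * c + \<theta> / pi < 1 + \<epsilon>" using \<theta> assms by (simp add: c_def)
    qed (use assms in simp)
    finally show ?thesis .
  qed
  ultimately show ?thesis using isotopy_contact_isotopy by blast
qed

end
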